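(* Let $d\ge1$, $\rho_0>0$, and let $\xi$ be the random parking measure in $\mathbb{R}^d$ with parameter $\rho_0$. Then $\xi$ is stationary (under real shifts), ergodic, isotropic, and almost surely general.
   Context: **Random parking measure with parameter $\rho_0$.** Let $\mathcal{P}$ be a homogeneous Poisson process of unit intensity on $\mathbb{R}^d\times[0,\infty)$, and let $B$ be the open Euclidean ball of radius $\rho_0$ centred at the origin. Make $\mathcal{P}$ the vertex set of an oriented graph $\mathcal{G}$ with an edge $(X,T)\to(X',T')$ whenever $(X+B)\cap(X'+B)\neq\emptyset$ and $T<T'$ (ties $T=T'$ broken by lexicographic order of $X,X'$; they have probability zero). If there is an edge from $x$ to $y$, $y$ is an offspring of $x$ and $x$ a parent of $y$; a root is a vertex without parent. Let $F_1$ be the set of roots of $\mathcal{G}$, $G_1$ the set of offspring of these roots, $H_1=F_1\cup G_1$; recursively, $F_{i+1}$ is the set of roots of the restriction of $\mathcal{G}$ to $\mathcal{P}\setminus(H_1\cup\dots\cup H_i)$, $G_{i+1}$ is the set of offspring of $F_{i+1}$ in this restricted graph, and $H_{i+1}=F_{i+1}\cup G_{i+1}$. (With probability 1, $F_1,G_1,F_2,G_2,\dots$ form a partition of $\mathcal{P}$.) The random parking measure $\xi$ in $\mathbb{R}^d$ is the projection on $\mathbb{R}^d$ of $\bigcup_{i\ge1}F_i$, identified with a random locally finite point set. **Terminology.** A random locally finite point set $\Sigma\subset\mathbb{R}^d$ is stationary if $\Sigma+x$ has the same distribution as $\Sigma$ for every $x\in\mathbb{R}^d$; ergodic if $P[\Sigma\in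 A]\in\{0,1\}$ for every measurable set $A$ of locally finite point sets that is invariant under all translations by $x\in\mathbb{R}^d$; isotropic if $\mathbf{R}\Sigma$ has the same distribution as $\Sigma$ for every rotation $\mathbf{R}\in SO_d$. A locally finite point set is general if no $d+1$ of its points lie in the same hyperplane and no $d+2$ of its points lie in the same hypersphere. *)

theory Defs
  imports "HOL-Probability.Probability" "HOL-Library.Fun_Lexorder"
begin

section \<open>Random locally finite point sets\<close>

definition locally_finite :: "'a::metric_space set \<Rightarrow> bool" where
  "locally_finite S \<longleftrightarrow> (\<forall>K. bounded K \<longrightarrow> finite (S \<inter> K))"

text \<open>
  The space of locally finite point sets carries the usual \<open>\<sigma>\<close>-algebra, generated by the counting
  maps \<open>S \<mapsto> card (S \<inter> A)\<close> of bounded Borel sets \<open>A\<close>. Only the measurable structure is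
  relevant; the measure itself is \<open>0\<close>.
\<close>

definition point_sets :: "'a::euclidean_space set measure" where
  "point_sets = sigma {S. locally_finite S}
     {{S. locally_finite S \<and> card (S \<inter> A) = n} | A n. A \<in> sets borel \<and> bounded A}"

definition random_point_set :: "'w measure \<Rightarrow> ('w \<Rightarrow> 'a::euclidean_space set) \<Rightarrow> bool" where
  "random_point_set M S \<longleftrightarrow> prob_space M \<and> S \<in> measurable M point_sets"

text \<open>
  Homogeneous Poisson process of unit intensity on a region \<open>E\<close>. The probability of \<open>k\<close> points
  is written out because \<^const>\<open>poisson_pmf\<close> requires a positive rate, whereas null sets \<open>A\<close>
  must be allowed here.
\<close>

definition unit_poisson_process ::
    "'w measure \<Rightarrow> 'a::euclidean_space set \<Rightarrow> ('w \<Rightarrow> 'a set) \<Rightarrow> bool" where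
  "unit_poisson_process M E P \<longleftrightarrow>
     random_point_set M P \<and>
     (\<forall>\<omega>\<in>space M. P \<omega> \<subseteq> E) \<and>
     (\<forall>A k. A \<in> sets borel \<longrightarrow> bounded A \<longrightarrow> A \<subseteq> E \<longrightarrow>
        measure M {\<omega> \<in> space M. card (P \<omega> \<inter> A) = k}
          = measure lborel A ^ k / fact k * exp (- measure lborel A)) \<and>
     (\<forall>(I :: nat set) A. finite I \<longrightarrow> disjoint_family_on A I \<longrightarrow>
        (\<forall>i\<in>I. A i \<in> sets borel \<and> bounded (A i) \<and> A i \<subseteq> E) \<longrightarrow>
        prob_space.indep_vars M (\<lambda>_. count_space UNIV) (\<lambda>i \<omega>. card (P \<omega> \<inter> A i)) I)"

definition stationary :: "'w measure \<Rightarrow> ('w \<Rightarrow> 'a::euclidean_space set) \<Rightarrow> bool" where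
  "stationary M S \<longleftrightarrow> random_point_set M S \<and>
     (\<forall>x. distr M point_sets (\<lambda>\<omega>. (+) x ` S \<omega>) = distr M point_sets S)"

definition ergodic :: "'w measure \<Rightarrow> ('w \<Rightarrow> 'a::euclidean_space set) \<Rightarrow> bool" where
  "ergodic M S \<longleftrightarrow> random_point_set M S \<and>
     (\<forall>A \<in> sets point_sets. (\<forall>x. (\<lambda>Q. (+) x ` Q) ` A = A) \<longrightarrow>
        measure M {\<omega> \<in> space M. S \<omega> \<in> A} \<in> {0, 1})"

definition isotropic :: "'w measure \<Rightarrow> ('w \<Rightarrow> (real ^ 'd) set) \<Rightarrow> bool" where
  "isotropic M S \<longleftrightarrow> random_point_set M S \<and>
     (\<forall>R :: real ^ 'd ^ 'd. rotation_matrix R \<longrightarrow>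
        distr M point_sets (\<lambda>\<omega>. (*v) R ` S \<omega>) = distr M point_sets S)"

definition general :: "'a::euclidean_space set \<Rightarrow> bool" where
  "general S \<longleftrightarrow> locally_finite S \<and>
     (\<forall>Q \<subseteq> S. finite Q \<longrightarrow> card Q = DIM('a) + 1 \<longrightarrow>
        \<not> (\<exists>a b. a \<noteq> 0 \<and> Q \<subseteq> {x. a \<bullet> x = b})) \<and>
     (\<forall>Q \<subseteq> S. finite Q \<longrightarrow> card Q = DIM('a) + 2 \<longrightarrow>
        \<not> (\<exists>c r. r > 0 \<and> Q \<subseteq> sphere c r))"


section \<open>Random parking\<close>

text \<open>
  Points are pairs of a position and an arrival time. The order on the index type \<open>'d\<close> only serves
  to number the coordinates, so that positions can be compared lexicographically.
\<close>

definition parking_edge ::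
    "real \<Rightarrow> (real ^ 'd::{finite,linorder}) \<times> real \<Rightarrow> (real ^ 'd::{finite,linorder}) \<times> real \<Rightarrow> bool" where
  "parking_edge \<rho> p q \<longleftrightarrow>
     (+) (fst p) ` ball 0 \<rho> \<inter> (+) (fst q) ` ball 0 \<rho> \<noteq> {} \<and>
     (snd p < snd q \<or> snd p = snd q \<and> less_fun (($) (fst p)) (($) (fst q)))"

definition parking_roots ::
    "real \<Rightarrow> ((real ^ 'd::{finite,linorder}) \<times> real) set \<Rightarrow> ((real ^ 'd::{finite,linorder}) \<times> real) set" where
  "parking_roots \<rho> V = {q \<in> V. \<not> (\<exists>p\<in>V. parking_edge \<rho> p q)}"

definition parking_offspring ::
    "real \<Rightarrow> ((real ^ 'd::{finite,linorder}) \<times> real) set \<Rightarrow> ((real ^ 'd::{finite,linorder}) \<times> real) set" where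
  "parking_offspring \<rho> V = {q \<in> V. \<exists>p\<in>parking_roots \<rho> V. parking_edge \<rho> p q}"

text \<open>
  \<open>parking_rest \<rho> V i\<close> is \<open>V - (H\<^sub>1 \<union> \<dots> \<union> H\<^sub>i)\<close>; hence \<open>F\<^sub>i\<^sub>+\<^sub>1\<close> and \<open>G\<^sub>i\<^sub>+\<^sub>1\<close> are its roots and
  their offspring.
\<close>

primrec parking_rest ::
    "real \<Rightarrow> ((real ^ 'd::{finite,linorder}) \<times> real) set \<Rightarrow> nat \<Rightarrow> ((real ^ 'd::{finite,linorder}) \<times> real) set" where
  "parking_rest \<rho> V 0 = V"
| "parking_rest \<rho> V (Suc i) = parking_rest \<rho> V i -
     (parking_roots \<rho> (parking_rest \<rho> V i) \<union> parking_offspring \<rho> (parking_rest \<rho> V i))"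

definition parking ::
    "real \<Rightarrow> ((real ^ 'd::{finite,linorder}) \<times> real) set \<Rightarrow> (real ^ 'd::{finite,linorder}) set" where
  "parking \<rho> V = fst ` (\<Union>i. parking_roots \<rho> (parking_rest \<rho> V i))"

definition random_parking_measure ::
    "'w measure \<Rightarrow> real \<Rightarrow> ('w \<Rightarrow> (real ^ 'd::{finite,linorder}) set) \<Rightarrow> bool" where
  "random_parking_measure M \<rho> \<xi> \<longleftrightarrow>
     (\<exists>P. unit_poisson_process M (UNIV \<times> {0..}) P \<and> (\<forall>\<omega>\<in>space M. \<xi> \<omega> = parking \<rho> (P \<omega>)))"

end

theory Submission
  imports Defs
begin

text \<open>
  The parking construction is a measurable function of the Poisson process that commutes with spatial
  translations, so stationarity and ergodicity are inherited from the Poisson process: its law is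
  determined by the counts of disjoint sets, and a translation invariant event is approximated by one
  depending on a bounded region, which becomes independent of itself after a far translation.
  Rotations preserve the lexicographic tie-breaking rule only in the absence of simultaneous arrivals,
  which almost surely do not occur. This and generality follow from one principle: a point of the
  process is independent of all others, so it almost surely avoids the null set of positions that are
  degenerate relative to them.
\<close>

section \<open>Measurability on the space of locally finite point sets\<close>

text \<open>The \<sigma>-algebra on point sets sees only counts of fixed bounded Borel sets, whereas
  the parking rule quantifies over the points of the set itself, in each of infinitely many rounds.
  The bridge is that the number of points satisfying a jointly measurable condition is measurable;
  roots, offspring and degenerate configurations become events in this way. The Poisson axioms speak
  of disjoint sets inside the region, so overlapping sets are cut into disjoint cells. Time is a
  half-line, so the translations used are those of the form \<open>(x, 0)\<close>. Distinct selected
  points are at distance at least \<open>2 * \<rho>\<close> in space: this makes the selected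
  positions locally finite and the projection injective on selected points, although cylinders over
  bounded sets are unbounded in time. General position is stated for a map \<open>\<phi>\<close>, so
  that one theorem serves three purposes: \<open>snd\<close> gives distinct arrival times,
  \<open>fst\<close> excludes hyperplanes, and a lift to a paraboloid excludes spheres.\<close>

lemma locally_finite_subset: "locally_finite S \<Longrightarrow> T \<subseteq> S \<Longrightarrow> locally_finite T"
  unfolding locally_finite_def by (meson Int_mono finite_subset order_refl)

lemma locally_finite_finite_Int: "locally_finite S \<Longrightarrow> bounded K \<Longrightarrow> finite (S \<inter> K)"
  by (simp add: locally_finite_def)

lemma space_point_sets: "space point_sets = {S. locally_finite S}"
  unfolding point_sets_def by (rule space_measure_of) auto

lemma sets_point_sets:
  "sets point_sets = sigma_sets {S. locally_finite S}
     {{S. locally_finite S \<and> card (S \<inter> A) = n} | A n. A \<in> sets borel \<and> bounded A}"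
  unfolding point_sets_def by (rule sets_measure_of) auto

lemma measurable_point_sets_card:
  assumes "A \<in> sets borel" "bounded A"
  shows "(\<lambda>S. card (S \<inter> A)) \<in> measurable point_sets (count_space UNIV)"
proof -
  have "(\<lambda>S. card (S \<inter> A)) -` {n} \<inter> space point_sets \<in> sets point_sets" for n
  proof -
    have "(\<lambda>S. card (S \<inter> A)) -` {n} \<inter> space point_sets = {S. locally_finite S \<and> card (S \<inter> A) = n}"
      by (auto simp: space_point_sets)
    also have "\<dots> \<in> sets point_sets"
      unfolding sets_point_sets using assms by (intro sigma_sets.Basic) blast
    finally show ?thesis .
  qed
  then show ?thesis
    by (subst measurable_count_space_eq2_countable) auto
qed

lemma measurable_card_Int:
  assumes "S \<in> measurable N point_sets" "A \<in> sets borel" "bounded A"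
  shows "(\<lambda>\<omega>. card (S \<omega> \<inter> A)) \<in> measurable N (count_space UNIV)"
  using measurable_compose[OF assms(1) measurable_point_sets_card[OF assms(2,3)]] .

lemma measurable_point_setsI:
  fixes S :: "'b \<Rightarrow> 'a::euclidean_space set"
  assumes "\<And>\<omega>. \<omega> \<in> space N \<Longrightarrow> locally_finite (S \<omega>)"
    and "\<And>A. A \<in> sets borel \<Longrightarrow> bounded A \<Longrightarrow>
      (\<lambda>\<omega>. card (S \<omega> \<inter> A)) \<in> measurable N (count_space UNIV)"
  shows "S \<in> measurable N point_sets"
proof (rule measurable_sigma_sets[OF sets_point_sets])
  fix Y :: "'a set set"
  assume "Y \<in> {{S. locally_finite S \<and> card (S \<inter> A) = n} | A n. A \<in> sets borel \<and> bounded A}"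
  then obtain A n where Y: "Y = {S. locally_finite S \<and> card (S \<inter> A) = n}"
    and A: "A \<in> sets borel" "bounded A" by blast
  have "S -` Y \<inter> space N = (\<lambda>\<omega>. card (S \<omega> \<inter> A)) -` {n} \<inter> space N"
    using assms(1) by (auto simp: Y)
  also have "\<dots> \<in> sets N"
    using assms(2)[OF A] by (rule measurable_sets) simp
  finally show "S -` Y \<inter> space N \<in> sets N" .
qed (use assms(1) in auto)

lemma locally_finite_value:
  "S \<in> measurable N point_sets \<Longrightarrow> \<omega> \<in> space N \<Longrightarrow> locally_finite (S \<omega>)"
  using measurable_space[of S N point_sets \<omega>] by (simp add: space_point_sets)

section \<open>Counts and quantifiers over the points of a random set\<close>

text \<open>A Dynkin argument in \<open>B\<close>: on a rectangle the count is an ordinary count of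
  a fixed set, switched off outside an event. The bounded window \<open>K\<close> keeps every count
  finite, so a complement is a subtraction and a disjoint union a sum.\<close>

lemma measurable_card_bounded_section:
  assumes S: "S \<in> measurable N point_sets" and K: "K \<in> sets borel" "bounded K"
    and B: "B \<in> sets (N \<Otimes>\<^sub>M borel)"
  shows "(\<lambda>\<omega>. real (card {p \<in> S \<omega> \<inter> K. (\<omega>, p) \<in> B})) \<in> borel_measurable N"
    (is "?c B \<in> _")
proof -
  let ?G = "{a \<times> b |a b. a \<in> sets N \<and> b \<in> sets (borel :: 'b measure)}"
  have fin: "finite (S \<omega> \<inter> K)" if "\<omega> \<in> space N" for \<omega>
    using locally_finite_finite_Int[OF locally_finite_value[OF S that] K(2)] .
  have B': "B \<in> sigma_sets (space N \<times> space borel) ?G"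
    using B by (simp add: sets_pair_measure)
  show ?thesis
  proof (rule sigma_sets_induct_disjoint[OF Int_stable_pair_measure_generator
        pair_measure_closed B'], goal_cases)
    case (1 A)
    then obtain a b where A: "A = a \<times> b" "a \<in> sets N" "b \<in> sets borel" by auto
    have "(\<lambda>\<omega>. real (card (S \<omega> \<inter> (K \<inter> b))) * indicator a \<omega>) \<in> borel_measurable N"
      using A K by (intro borel_measurable_times borel_measurable_indicator
        measurable_compose[OF measurable_card_Int[OF S]]) (auto intro: bounded_subset)
    also have "(\<lambda>\<omega>. real (card (S \<omega> \<inter> (K \<inter> b))) * indicator a \<omega>) = ?c A"
      by (auto simp: A fun_eq_iff indicator_def intro!: arg_cong[where f=card])
    finally show ?case .
  next
    case 2 show ?case by simp
  next
    case (3 A)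
    have "(\<lambda>\<omega>. real (card (S \<omega> \<inter> K)) - ?c A \<omega>) \<in> borel_measurable N"
      using 3 K by (intro borel_measurable_diff measurable_compose[OF measurable_card_Int[OF S]]) auto
    moreover have "real (card (S \<omega> \<inter> K)) - ?c A \<omega> = ?c (space N \<times> space borel - A) \<omega>"
      if \<omega>: "\<omega> \<in> space N" for \<omega>
    proof -
      have eq: "{p \<in> S \<omega> \<inter> K. (\<omega>, p) \<in> space N \<times> space borel - A}
          = S \<omega> \<inter> K - {p \<in> S \<omega> \<inter> K. (\<omega>, p) \<in> A}"
        using \<omega> by auto
      then show ?thesis
        unfolding eq using fin[OF \<omega>]
        by (subst card_Diff_subset) (auto intro!: of_nat_diff[symmetric] card_mono intro: rev_finite_subset)
    qed
    ultimately show ?case by (simp cong: measurable_cong)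
  next
    case (4 A)
    have "(\<lambda>\<omega>. \<Sum>i. ?c (A i) \<omega>) \<in> borel_measurable N"
      using 4 by (intro borel_measurable_suminf) auto
    moreover have "(\<Sum>i. ?c (A i) \<omega>) = ?c (\<Union>i. A i) \<omega>" if \<omega>: "\<omega> \<in> space N" for \<omega>
    proof -
      \<comment> \<open>Choosing one point from each nonempty piece injects \<open>J\<close> into
        the finite set \<open>S \<omega> \<inter> K\<close>, so all but finitely many terms of the
        series vanish.\<close>
      define J where "J = {i. {p \<in> S \<omega> \<inter> K. (\<omega>, p) \<in> A i} \<noteq> {}}"
      define q where "q i = (SOME p. p \<in> {p \<in> S \<omega> \<inter> K. (\<omega>, p) \<in> A i})" for i
      have q: "q i \<in> S \<omega> \<inter> K" "(\<omega>, q i) \<in> A i" if "i \<in> J" for i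
        using that someI_ex[of "\<lambda>p. p \<in> {p \<in> S \<omega> \<inter> K. (\<omega>, p) \<in> A i}"]
        unfolding q_def J_def by blast+
      have "inj_on q J"
        using q(2) 4(1) by (intro inj_onI) (metis disjoint_family_onD UNIV_I disjoint_iff)
      moreover have "q ` J \<subseteq> S \<omega> \<inter> K" using q by auto
      ultimately have J: "finite J" using fin[OF \<omega>] by (metis finite_imageD finite_subset)
      have "(\<Sum>i. ?c (A i) \<omega>) = (\<Sum>i\<in>J. ?c (A i) \<omega>)"
        by (intro suminf_finite J) (auto simp: J_def card_eq_0_iff)
      also have "\<dots> = real (card (\<Union>i\<in>J. {p \<in> S \<omega> \<inter> K. (\<omega>, p) \<in> A i}))"
        using J fin[OF \<omega>] 4(1)
        by (subst card_UN_disjoint) (auto simp: disjoint_family_on_def intro: rev_finite_subset)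
      also have "(\<Union>i\<in>J. {p \<in> S \<omega> \<inter> K. (\<omega>, p) \<in> A i}) = {p \<in> S \<omega> \<inter> K. (\<omega>, p) \<in> (\<Union>i. A i)}"
        by (auto simp: J_def)
      finally show ?thesis .
    qed
    ultimately show ?case by (simp cong: measurable_cong)
  qed
qed

text \<open>No measurable enumeration of the random points is at hand, so the quantifier is not
  visibly countable. It becomes so over balls: some ball of integer radius contains a nonzero number
  of points satisfying \<open>R\<close>.\<close>

lemma pred_Bex_point_set:
  assumes S: "S \<in> measurable N point_sets"
    and R: "Measurable.pred (N \<Otimes>\<^sub>M borel) (\<lambda>x. R (fst x) (snd x))"
  shows "Measurable.pred N (\<lambda>\<omega>. \<exists>p\<in>S \<omega>. R \<omega> p)"
proof -
  define B where "B = {x \<in> space (N \<Otimes>\<^sub>M borel). R (fst x) (snd x)}"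
  have B: "B \<in> sets (N \<Otimes>\<^sub>M borel)" using R by (simp add: B_def)
  have "Measurable.pred N (\<lambda>\<omega>. \<exists>n::nat. real (card {p \<in> S \<omega> \<inter> ball 0 (real n). (\<omega>, p) \<in> B}) \<noteq> 0)"
    using measurable_card_bounded_section[OF S _ _ B] by measurable
  also have "?this \<longleftrightarrow> ?thesis"
  proof (intro measurable_cong)
    fix \<omega> assume \<omega>: "\<omega> \<in> space N"
    have "finite {p \<in> S \<omega> \<inter> ball 0 (real n). (\<omega>, p) \<in> B}" for n
      using locally_finite_finite_Int[OF locally_finite_value[OF S \<omega>], of "ball 0 (real n)"]
      by (rule finite_subset[rotated]) auto
    moreover have "\<exists>n. p \<in> ball 0 (real n)" for p :: 'b
      using reals_Archimedean2[of "norm p"] by auto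
    ultimately show "(\<exists>n::nat. real (card {p \<in> S \<omega> \<inter> ball 0 (real n). (\<omega>, p) \<in> B}) \<noteq> 0)
        \<longleftrightarrow> (\<exists>p\<in>S \<omega>. R \<omega> p)"
      using \<omega> by (auto simp: B_def space_pair_measure) blast
  qed
  finally show ?thesis .
qed

text \<open>Finiteness is assumed pointwise instead of through a fixed window: the counts in growing
  balls are then eventually constant, and their limit is measurable. The parking set calls for this
  form, since its space-time cylinders are unbounded in time.\<close>

lemma measurable_card_section:
  assumes S: "S \<in> measurable N point_sets"
    and R: "Measurable.pred (N \<Otimes>\<^sub>M borel) (\<lambda>x. R (fst x) (snd x))"
    and fin: "\<And>\<omega>. \<omega> \<in> space N \<Longrightarrow> finite {p \<in> S \<omega>. R \<omega> p}"
  shows "(\<lambda>\<omega>. card {p \<in> S \<omega>. R \<omega> p}) \<in> measurable N (count_space UNIV)"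
proof -
  define B where "B = {x \<in> space (N \<Otimes>\<^sub>M borel). R (fst x) (snd x)}"
  have B: "B \<in> sets (N \<Otimes>\<^sub>M borel)" using R by (simp add: B_def)
  let ?c = "\<lambda>n \<omega>. real (card {p \<in> S \<omega> \<inter> ball 0 (real n). (\<omega>, p) \<in> B})"
  have "(\<lambda>\<omega>. lim (\<lambda>n. ?c n \<omega>)) \<in> borel_measurable N"
    using measurable_card_bounded_section[OF S _ _ B] by measurable
  moreover have "lim (\<lambda>n. ?c n \<omega>) = real (card {p \<in> S \<omega>. R \<omega> p})" if \<omega>: "\<omega> \<in> space N" for \<omega>
  proof (rule limI, rule tendsto_eventually)
    obtain r where r: "\<And>p. p \<in> S \<omega> \<Longrightarrow> R \<omega> p \<Longrightarrow> norm p < r"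
      using finite_imp_bounded[OF fin[OF \<omega>]] unfolding bounded_pos_less by blast
    show "\<forall>\<^sub>F n in sequentially. ?c n \<omega> = real (card {p \<in> S \<omega>. R \<omega> p})"
      using eventually_ge_at_top[of "nat \<lceil>r\<rceil>"]
    proof eventually_elim
      case (elim n)
      then have "r \<le> real n" by linarith
      then have "{p \<in> S \<omega> \<inter> ball 0 (real n). (\<omega>, p) \<in> B} = {p \<in> S \<omega>. R \<omega> p}"
        using \<omega> r by (force simp: B_def space_pair_measure)
      then show ?case by simp
    qed
  qed
  ultimately have "(\<lambda>\<omega>. real (card {p \<in> S \<omega>. R \<omega> p})) \<in> borel_measurable N"
    by (simp cong: measurable_cong)
  from measurable_compose[OF this, of "\<lambda>x. nat \<lfloor>x\<rfloor>" "count_space UNIV"] show ?thesis by simp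
qed

lemma measurable_point_sets_filter:
  assumes S: "S \<in> measurable N point_sets"
    and R: "Measurable.pred (N \<Otimes>\<^sub>M borel) (\<lambda>x. R (fst x) (snd x))"
  shows "(\<lambda>\<omega>. {p \<in> S \<omega>. R \<omega> p}) \<in> measurable N point_sets"
proof (rule measurable_point_setsI)
  fix \<omega> assume "\<omega> \<in> space N"
  then show "locally_finite {p \<in> S \<omega>. R \<omega> p}"
    using locally_finite_value[OF S] by (auto intro: locally_finite_subset)
next
  fix A :: "'b set" assume A: "A \<in> sets borel" "bounded A"
  have "(\<lambda>\<omega>. card {p \<in> S \<omega>. R \<omega> p \<and> p \<in> A}) \<in> measurable N (count_space UNIV)"
  proof (rule measurable_card_section[OF S])
    show "Measurable.pred (N \<Otimes>\<^sub>M borel) (\<lambda>x. R (fst x) (snd x) \<and> snd x \<in> A)"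
      using R A(1) by measurable
    fix \<omega> assume "\<omega> \<in> space N"
    from locally_finite_finite_Int[OF locally_finite_value[OF S this] A(2)]
    show "finite {p \<in> S \<omega>. R \<omega> p \<and> p \<in> A}"
      by (rule finite_subset[rotated]) auto
  qed
  also have "(\<lambda>\<omega>. {p \<in> S \<omega>. R \<omega> p \<and> p \<in> A}) = (\<lambda>\<omega>. {p \<in> S \<omega>. R \<omega> p} \<inter> A)" by auto
  finally show "(\<lambda>\<omega>. card ({p \<in> S \<omega>. R \<omega> p} \<inter> A)) \<in> measurable N (count_space UNIV)" .
qed

lemma measurable_point_sets_Int:
  assumes "S \<in> measurable N point_sets" "A \<in> sets borel"
  shows "(\<lambda>\<omega>. S \<omega> \<inter> A) \<in> measurable N point_sets"
proof -
  have "(\<lambda>\<omega>. {p \<in> S \<omega>. p \<in> A}) \<in> measurable N point_sets"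
    using assms by (intro measurable_point_sets_filter) auto
  then show ?thesis by (simp add: Int_def)
qed

text \<open>A count of the image in \<open>A\<close> is a count of the original in the preimage of
  \<open>A\<close> under \<open>g\<close>. Measurability of that preimage comes from
  \<open>g\<close>, its boundedness from the inverse \<open>h\<close>.\<close>

lemma measurable_point_sets_image:
  fixes g h :: "'a::euclidean_space \<Rightarrow> 'a"
  assumes S: "S \<in> measurable N point_sets"
    and hg: "\<And>x. h (g x) = x" and gh: "\<And>x. g (h x) = x"
    and g: "g \<in> borel_measurable borel"
    and bdd: "\<And>A. bounded A \<Longrightarrow> bounded (h ` A)"
  shows "(\<lambda>\<omega>. g ` S \<omega>) \<in> measurable N point_sets"
proof -
  have inj: "inj g" by (metis hg injI)
  have hA: "h ` A = g -` A" for A by (auto simp: gh) (metis hg image_eqI)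
  have eq: "g ` V \<inter> A = g ` (V \<inter> h ` A)" for V A
    unfolding hA by auto
  show ?thesis
  proof (rule measurable_point_setsI)
    fix \<omega> assume "\<omega> \<in> space N"
    from locally_finite_value[OF S this] show "locally_finite (g ` S \<omega>)"
      unfolding locally_finite_def eq using bdd by auto
  next
    fix A :: "'a set" assume "A \<in> sets borel" "bounded A"
    then have "h ` A \<in> sets borel" "bounded (h ` A)"
      using measurable_sets[OF g, of A] bdd by (auto simp: hA)
    from measurable_card_Int[OF S this]
    show "(\<lambda>\<omega>. card (g ` S \<omega> \<inter> A)) \<in> measurable N (count_space UNIV)"
      unfolding eq using inj by (subst card_image) (auto intro: inj_on_subset)
  qed
qed

section \<open>The law of a Poisson process\<close>

text \<open>The independence axiom concerns disjoint sets, while the events generating the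
  \<sigma>-algebra count overlapping ones. Adding a set splits each old cell in two and contributes
  its uncovered remainder.\<close>

lemma finite_disjoint_refinement:
  fixes \<A> :: "'a::euclidean_space set set"
  assumes "finite \<A>" "\<forall>A\<in>\<A>. A \<in> sets borel \<and> bounded A"
  shows "\<exists>n (C :: nat \<Rightarrow> 'a set). 0 < n \<and> disjoint_family_on C {..<n} \<and>
    (\<forall>i<n. C i \<in> sets borel \<and> bounded (C i) \<and> C i \<subseteq> \<Union>\<A>) \<and>
    (\<forall>A\<in>\<A>. \<exists>J\<subseteq>{..<n}. A = (\<Union>i\<in>J. C i))"
  using assms
proof (induction \<A> rule: finite_induct)
  case empty
  \<comment> \<open>One empty cell instead of none keeps the index set nonempty, as the product
    description of independence in \<open>poisson_counts_law\<close> asks.\<close>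
  show ?case by (rule exI[of _ 1], rule exI[of _ "\<lambda>_. {}"]) (auto simp: disjoint_family_on_def)
next
  case (insert A \<A>)
  have "\<forall>A\<in>\<A>. A \<in> sets borel \<and> bounded A" using insert.prems by blast
  from insert.IH[OF this] obtain n and C :: "nat \<Rightarrow> 'a set" where dis: "disjoint_family_on C {..<n}"
    and C: "\<forall>i<n. C i \<in> sets borel \<and> bounded (C i) \<and> C i \<subseteq> \<Union>\<A>"
    and J: "\<forall>A\<in>\<A>. \<exists>J\<subseteq>{..<n}. A = (\<Union>i\<in>J. C i)"
    by (elim exE conjE)
  note C = C[rule_format] and J = J[THEN bspec]
  have A: "A \<in> sets borel" "bounded A" using insert.prems by auto
  \<comment> \<open>Indices below \<open>n\<close> hold the parts inside \<open>A\<close>, the next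
    \<open>n\<close> the parts outside, and \<open>2 * n\<close> the part of \<open>A\<close> that
    no old cell covers.\<close>
  define D where "D i = (if i < n then C i \<inter> A else if i < 2 * n then C (i - n) - A
      else A - (\<Union>i<n. C i))" for i
  have D: "D i = C i \<inter> A" "D (n + i) = C i - A" if "i < n" for i
    using that by (auto simp: D_def)
  have D2: "D (2 * n) = A - (\<Union>i<n. C i)" by (simp add: D_def)
  have cases: "i < n \<or> (\<exists>j<n. i = n + j) \<or> i = 2 * n" if "i < 2 * n + 1" for i
    using that by (auto intro!: exI[of _ "i - n"])
  show ?case
  proof (intro exI[of _ "2 * n + 1"] exI[of _ D] conjI allI impI ballI)
    show "0 < 2 * n + 1" by simp
    show "disjoint_family_on D {..<2 * n + 1}"
      unfolding disjoint_family_on_def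
    proof (intro ballI impI)
      fix i j assume "i \<in> {..<2 * n + 1}" "j \<in> {..<2 * n + 1}" "i \<noteq> j"
      with cases[of i] cases[of j] show "D i \<inter> D j = {}"
        using dis by (auto simp: D D2 disjoint_family_on_def) blast+
    qed
  next
    fix i assume "i < 2 * n + 1"
    note i = cases[OF this]
    have "C j \<in> sets borel" if "j < n" for j using C that by blast
    with i A show "D i \<in> sets borel" by (auto simp: D D2)
    from i A C show "D i \<subseteq> \<Union>(insert A \<A>)" by (fastforce simp: D D2)
    from i A C show "bounded (D i)" by (auto simp: D D2 bounded_Int bounded_diff)
  next
    fix B assume "B \<in> insert A \<A>"
    then show "\<exists>J\<subseteq>{..<2 * n + 1}. B = (\<Union>i\<in>J. D i)"
    proof
      assume "B = A"
      then have "B = (\<Union>i\<in>insert (2 * n) {..<n}. D i)"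
        by (auto simp: D D2)
      then show ?thesis by (intro exI[of _ "insert (2 * n) {..<n}"]) auto
    next
      assume "B \<in> \<A>"
      from J[OF this] obtain I where I: "I \<subseteq> {..<n}" "B = (\<Union>i\<in>I. C i)" by auto
      have "(\<Union>i\<in>I \<union> (+) n ` I. D i) = (\<Union>i\<in>I. (C i \<inter> A) \<union> (C i - A))"
        using I(1) by (auto simp: D subset_iff Bex_def)
      also have "\<dots> = B" using I(2) by auto
      finally show ?thesis using I(1) by (intro exI[of _ "I \<union> (+) n ` I"]) auto
    qed
  qed
qed

text \<open>Prescribing finitely many counts at once makes the family closed under intersection,
  unlike the single-count generators; it is the \<pi>-system for both uniqueness and
  independence.\<close>

definition count_events :: "'a::euclidean_space set set set" where
  "count_events = {{S. locally_finite S \<and> (\<forall>(A, n)\<in>F. card (S \<inter> A) = n)} | F.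
     finite F \<and> (\<forall>(A, n)\<in>F. A \<in> sets borel \<and> bounded A)}"

lemma Int_stable_count_events: "Int_stable count_events"
proof (rule Int_stableI)
  fix D D' :: "'a set set" assume "D \<in> count_events" "D' \<in> count_events"
  then obtain F F' where
    "D = {S. locally_finite S \<and> (\<forall>(A, n)\<in>F. card (S \<inter> A) = n)}"
    "D' = {S. locally_finite S \<and> (\<forall>(A, n)\<in>F'. card (S \<inter> A) = n)}"
    and F: "finite F" "\<forall>(A, n)\<in>F. A \<in> sets borel \<and> bounded A"
      "finite F'" "\<forall>(A, n)\<in>F'. A \<in> sets borel \<and> bounded A"
    unfolding count_events_def by blast
  then have "D \<inter> D' = {S. locally_finite S \<and> (\<forall>(A, n)\<in>F \<union> F'. card (S \<inter> A) = n)}"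
    by (auto simp: ball_Un case_prod_beta)
  moreover have "finite (F \<union> F') \<and> (\<forall>(A, n)\<in>F \<union> F'. A \<in> sets borel \<and> bounded A)"
    using F by auto
  ultimately show "D \<inter> D' \<in> count_events" unfolding count_events_def by blast
qed

lemma space_in_count_events: "{S :: 'a::euclidean_space set. locally_finite S} \<in> count_events"
  unfolding count_events_def
proof (intro CollectI exI conjI)
  show "{S. locally_finite S} = {S :: 'a set. locally_finite S \<and> (\<forall>(A, n)\<in>{}. card (S \<inter> A) = n)}"
    by simp
qed auto

lemma count_events_subset: "count_events \<subseteq> sets point_sets"
proof
  fix D :: "'a set set" assume "D \<in> count_events"
  then obtain F where D: "D = {S. locally_finite S \<and> (\<forall>(A, n)\<in>F. card (S \<inter> A) = n)}"
    and F: "finite F" "\<forall>(A, n)\<in>F. A \<in> sets borel \<and> bounded A"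
    unfolding count_events_def by blast
  have "{S \<in> space point_sets. \<forall>x\<in>F. card (S \<inter> fst x) = snd x} \<in> sets point_sets"
  proof (rule sets.sets_Collect_finite_All[OF _ F(1)])
    fix x assume "x \<in> F"
    then have "fst x \<in> sets borel" "bounded (fst x)" using F(2) by auto
    from measurable_sets[OF measurable_point_sets_card[OF this], of "{snd x}"]
    show "{S \<in> space point_sets. card (S \<inter> fst x) = snd x} \<in> sets point_sets"
      by (simp add: vimage_def Int_def conj_commute)
  qed
  then show "D \<in> sets point_sets"
    by (simp add: D space_point_sets case_prod_beta)
qed

lemma sets_point_sets_count_events:
  "sets point_sets = sigma_sets {S. locally_finite S} count_events"
proof
  show "sigma_sets {S. locally_finite S} count_events \<subseteq> sets point_sets"
    using sets.sigma_sets_subset[OF count_events_subset] by (simp add: space_point_sets)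
  show "sets point_sets \<subseteq> sigma_sets {S. locally_finite S} (count_events :: 'a set set set)"
    unfolding sets_point_sets
  proof (rule sigma_sets_mono', clarify)
    fix A :: "'a set" and n assume "A \<in> sets borel" "bounded A"
    then show "{S. locally_finite S \<and> card (S \<inter> A) = n} \<in> count_events"
      unfolding count_events_def by (intro CollectI exI[of _ "{(A, n)}"]) auto
  qed
qed

lemma unit_poisson_processD:
  assumes "unit_poisson_process M E P"
  shows "prob_space M" "P \<in> measurable M point_sets" "\<And>\<omega>. \<omega> \<in> space M \<Longrightarrow> P \<omega> \<subseteq> E"
    "\<And>A k. A \<in> sets borel \<Longrightarrow> bounded A \<Longrightarrow> A \<subseteq> E \<Longrightarrow>
       measure M {\<omega> \<in> space M. card (P \<omega> \<inter> A) = k}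
         = measure lborel A ^ k / fact k * exp (- measure lborel A)"
    "\<And>(I :: nat set) A. finite I \<Longrightarrow> disjoint_family_on A I \<Longrightarrow>
       (\<And>i. i \<in> I \<Longrightarrow> A i \<in> sets borel \<and> bounded (A i) \<and> A i \<subseteq> E) \<Longrightarrow>
       prob_space.indep_vars M (\<lambda>_. count_space UNIV) (\<lambda>i \<omega>. card (P \<omega> \<inter> A i)) I"
  using assms unfolding unit_poisson_process_def random_point_set_def by simp_all

lemma card_UN_Int_finite:
  assumes "locally_finite S" "finite J" "disjoint_family_on C J" "\<And>i. i \<in> J \<Longrightarrow> bounded (C i)"
  shows "card (S \<inter> (\<Union>i\<in>J. C i)) = (\<Sum>i\<in>J. card (S \<inter> C i))"
proof -
  have "S \<inter> (\<Union>i\<in>J. C i) = (\<Union>i\<in>J. S \<inter> C i)" by auto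
  also have "card \<dots> = (\<Sum>i\<in>J. card (S \<inter> C i))"
    using assms by (intro card_UN_disjoint)
      (auto simp: disjoint_family_on_def locally_finite_finite_Int)
  finally show ?thesis .
qed

text \<open>For subsets of \<open>E\<close>, each prescribed count is a sum of counts of disjoint
  cells, to which the Poisson axioms apply.\<close>

lemma count_event_disjoint:
  fixes E :: "'a::euclidean_space set"
  assumes E: "E \<in> sets borel" and F: "finite F" "\<forall>(A, n)\<in>F. A \<in> sets borel \<and> bounded A"
  obtains n :: nat and C :: "nat \<Rightarrow> 'a set" and Q where "0 < n" "disjoint_family_on C {..<n}"
    and "\<And>i. i < n \<Longrightarrow> C i \<in> sets borel \<and> bounded (C i) \<and> C i \<subseteq> E"
    and "Q \<in> sets (PiM {..<n} (\<lambda>_. count_space UNIV))"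
    and "\<And>S. locally_finite S \<Longrightarrow> S \<subseteq> E \<Longrightarrow>
      (\<forall>(A, k)\<in>F. card (S \<inter> A) = k) \<longleftrightarrow> (\<lambda>i\<in>{..<n}. card (S \<inter> C i)) \<in> Q"
proof -
  \<comment> \<open>Cutting down to \<open>E\<close> changes no count, because only sets
    \<open>S \<subseteq> E\<close> are considered, and it puts every cell inside the region of the
    axioms.\<close>
  let ?A = "(\<lambda>x. fst x \<inter> E) ` F"
  have "finite ?A" "\<forall>A\<in>?A. A \<in> sets borel \<and> bounded A"
    using F E by (auto intro: bounded_subset)
  from finite_disjoint_refinement[OF this] obtain n and C :: "nat \<Rightarrow> 'a set"
    where n: "0 < n" and dis: "disjoint_family_on C {..<n}"
    and C: "\<forall>i<n. C i \<in> sets borel \<and> bounded (C i) \<and> C i \<subseteq> \<Union>?A"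
    and CJ: "\<forall>A\<in>?A. \<exists>J\<subseteq>{..<n}. A = (\<Union>i\<in>J. C i)" by (elim exE conjE)
  note C = C[rule_format]
  from CJ have "\<forall>x\<in>F. \<exists>J\<subseteq>{..<n}. fst x \<inter> E = (\<Union>i\<in>J. C i)" by blast
  then obtain J where J: "\<And>x. x \<in> F \<Longrightarrow> J x \<subseteq> {..<n} \<and> fst x \<inter> E = (\<Union>i\<in>J x. C i)"
    by metis
  define Q where "Q = {c \<in> space (PiM {..<n} (\<lambda>_. count_space UNIV)).
    \<forall>x\<in>F. (\<Sum>i\<in>J x. c i) = (snd x :: nat)}"
  show thesis
  proof (rule that)
    show "0 < n" by fact
    show "disjoint_family_on C {..<n}" by fact
    show "C i \<in> sets borel \<and> bounded (C i) \<and> C i \<subseteq> E" if "i < n" for i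
      using C[OF that] by auto
    \<comment> \<open>A finite product of countable discrete spaces is discrete, so every set of
      count vectors is measurable.\<close>
    show "Q \<in> sets (PiM {..<n} (\<lambda>_. count_space UNIV))"
      by (simp add: Q_def count_space_PiM_finite space_PiM)
    fix S assume S: "locally_finite S" "S \<subseteq> E"
    have "card (S \<inter> fst x) = (\<Sum>i\<in>J x. card (S \<inter> C i))" if "x \<in> F" for x
    proof -
      have "S \<inter> fst x = S \<inter> (\<Union>i\<in>J x. C i)" using S(2) J[OF that] by auto
      moreover have "disjoint_family_on C (J x)" "finite (J x)"
        using dis J[OF that] by (auto intro: disjoint_family_on_mono finite_subset)
      ultimately show ?thesis using C J[OF that] S(1)
        by (simp add: card_UN_Int_finite subset_iff)
    qed
    moreover have "(\<Sum>i\<in>J x. card (S \<inter> C i)) = (\<Sum>i\<in>J x. (\<lambda>i\<in>{..<n}. card (S \<inter> C i)) i)" if "x \<in> F" for x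
      using J[OF that] by (intro sum.cong) auto
    ultimately have "card (S \<inter> fst x) = (\<Sum>i\<in>J x. (\<lambda>i\<in>{..<n}. card (S \<inter> C i)) i)" if "x \<in> F" for x
      using that by metis
    then have "(\<forall>x\<in>F. card (S \<inter> fst x) = snd x) \<longleftrightarrow> (\<lambda>i\<in>{..<n}. card (S \<inter> C i)) \<in> Q"
      unfolding Q_def space_PiM by (simp only: mem_Collect_eq cong: ball_cong) auto
    then show "(\<forall>(A, k)\<in>F. card (S \<inter> A) = k) \<longleftrightarrow> (\<lambda>i\<in>{..<n}. card (S \<inter> C i)) \<in> Q"
      by (simp add: case_prod_beta)
  qed
qed

lemma poisson_counts_law:
  fixes n :: nat and C :: "nat \<Rightarrow> 'a::euclidean_space set"
  assumes P: "unit_poisson_process M E P" and n: "0 < n" and C: "disjoint_family_on C {..<n}"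
    "\<And>i. i < n \<Longrightarrow> C i \<in> sets borel \<and> bounded (C i) \<and> C i \<subseteq> E"
  shows "distr M (PiM {..<n} (\<lambda>_. count_space UNIV)) (\<lambda>\<omega>. \<lambda>i\<in>{..<n}. card (P \<omega> \<inter> C i))
    = PiM {..<n} (\<lambda>i. distr M (count_space UNIV) (\<lambda>\<omega>. card (P \<omega> \<inter> C i)))"
proof -
  interpret prob_space M by (rule unit_poisson_processD[OF P])
  have rv: "random_variable (count_space UNIV) (\<lambda>\<omega>. card (P \<omega> \<inter> C i))" if "i < n" for i
    using C(2)[OF that] by (intro measurable_card_Int unit_poisson_processD[OF P]) auto
  show ?thesis
    using indep_vars_iff_distr_eq_PiM'[of "{..<n}" "\<lambda>i \<omega>. card (P \<omega> \<inter> C i)" "\<lambda>_. count_space UNIV"]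
      unit_poisson_processD(5)[OF P _ C(1)] C(2) rv n by (simp add: lessThan_empty_iff)
qed

text \<open>The cell counts are independent, with probabilities fixed by the volumes of the cells,
  so both processes agree on the \<pi>-system. Stationarity and isotropy thereby reduce to checking
  that a transformed process satisfies the same axioms.\<close>

lemma poisson_law_unique:
  fixes E :: "'a::euclidean_space set"
  assumes E: "E \<in> sets borel"
    and P: "unit_poisson_process M E P" and P': "unit_poisson_process M' E P'"
  shows "distr M point_sets P = distr M' point_sets P'"
proof (rule measure_eqI_generator_eq[OF Int_stable_count_events, of "{S. locally_finite S}"])
  interpret M: prob_space M by (rule unit_poisson_processD[OF P])
  interpret M': prob_space M' by (rule unit_poisson_processD[OF P'])
  note meas = unit_poisson_processD(2)[OF P] unit_poisson_processD(2)[OF P']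
  show "count_events \<subseteq> Pow {S. locally_finite S}"
    using count_events_subset sets.space_closed[of point_sets] unfolding space_point_sets by (rule subset_trans)
  show "sets (distr M point_sets P) = sigma_sets {S. locally_finite S} count_events"
    "sets (distr M' point_sets P') = sigma_sets {S. locally_finite S} count_events"
    by (simp_all add: sets_point_sets_count_events)
  show "range (\<lambda>_. {S. locally_finite S}) \<subseteq> count_events"
    using space_in_count_events by auto
  show "emeasure (distr M point_sets P) {S. locally_finite S} \<noteq> \<infinity>" for i :: nat
    using M.emeasure_finite by (simp add: emeasure_distr meas flip: space_point_sets)
  fix D :: "'a set set" assume "D \<in> count_events"
  then obtain F where D: "D = {S. locally_finite S \<and> (\<forall>(A, n)\<in>F. card (S \<inter> A) = n)}"
    and F: "finite F" "\<forall>(A, n)\<in>F. A \<in> sets borel \<and> bounded A"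
    unfolding count_events_def by blast
  obtain n :: nat and C :: "nat \<Rightarrow> 'a set" and Q where n: "0 < n" and C: "disjoint_family_on C {..<n}"
     "\<And>i. i < n \<Longrightarrow> C i \<in> sets borel \<and> bounded (C i) \<and> C i \<subseteq> E"
    and Q: "Q \<in> sets (PiM {..<n} (\<lambda>_. count_space UNIV))"
     "\<And>S. locally_finite S \<Longrightarrow> S \<subseteq> E \<Longrightarrow>
      (\<forall>(A, k)\<in>F. card (S \<inter> A) = k) \<longleftrightarrow> (\<lambda>i\<in>{..<n}. card (S \<inter> C i)) \<in> Q"
    using count_event_disjoint[OF E F] by blast
  have *: "emeasure (distr N point_sets X) D
      = emeasure (PiM {..<n} (\<lambda>i. distr N (count_space UNIV) (\<lambda>\<omega>. card (X \<omega> \<inter> C i)))) Q"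
    if X: "unit_poisson_process N E X" for N :: "'x measure" and X
  proof -
    note X' = unit_poisson_processD[OF X]
    have rv: "(\<lambda>\<omega>. \<lambda>i\<in>{..<n}. card (X \<omega> \<inter> C i)) \<in> N \<rightarrow>\<^sub>M PiM {..<n} (\<lambda>_. count_space UNIV)"
      using C(2) by (intro measurable_restrict measurable_card_Int X') auto
    have "emeasure (distr N point_sets X) D = emeasure N {\<omega> \<in> space N. X \<omega> \<in> D}"
      using subsetD[OF count_events_subset \<open>D \<in> count_events\<close>]
      by (simp add: emeasure_distr[OF X'(2)] vimage_def Int_def conj_commute)
    also have "{\<omega> \<in> space N. X \<omega> \<in> D} = (\<lambda>\<omega>. \<lambda>i\<in>{..<n}. card (X \<omega> \<inter> C i)) -` Q \<inter> space N"
    proof -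
      have "X \<omega> \<in> D \<longleftrightarrow> (\<lambda>i\<in>{..<n}. card (X \<omega> \<inter> C i)) \<in> Q" if "\<omega> \<in> space N" for \<omega>
      using Q(2)[OF locally_finite_value[OF X'(2) that] X'(3)[OF that]]
        locally_finite_value[OF X'(2) that] by (simp add: D case_prod_beta)
      then show ?thesis by auto
    qed
    also have "emeasure N \<dots> = emeasure (distr N (PiM {..<n} (\<lambda>_. count_space UNIV)) (\<lambda>\<omega>. \<lambda>i\<in>{..<n}. card (X \<omega> \<inter> C i))) Q"
      using rv Q(1) by (simp add: emeasure_distr)
    finally show ?thesis using poisson_counts_law[OF X n C] by simp
  qed
  have "distr M (count_space UNIV) (\<lambda>\<omega>. card (P \<omega> \<inter> C i))
      = distr M' (count_space UNIV) (\<lambda>\<omega>. card (P' \<omega> \<inter> C i))" if "i < n" for i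
  proof (rule measure_eqI_countable[of _ UNIV])
    fix k
    have eq: "emeasure (distr N (count_space UNIV) (\<lambda>\<omega>. card (X \<omega> \<inter> C i))) {k}
       = ennreal (measure lborel (C i) ^ k / fact k * exp (- measure lborel (C i)))"
      if X: "unit_poisson_process N E X" for N :: "'x measure" and X
    proof -
      interpret prob_space N by (rule unit_poisson_processD[OF X])
      have "(\<lambda>\<omega>. card (X \<omega> \<inter> C i)) \<in> N \<rightarrow>\<^sub>M count_space UNIV"
        using C(2)[OF \<open>i < n\<close>] by (intro measurable_card_Int unit_poisson_processD[OF X]) auto
      then have "emeasure (distr N (count_space UNIV) (\<lambda>\<omega>. card (X \<omega> \<inter> C i))) {k}
        = emeasure N {\<omega> \<in> space N. card (X \<omega> \<inter> C i) = k}"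
        by (auto simp: emeasure_distr intro!: arg_cong[where f="emeasure N"])
      also have "\<dots> = ennreal (measure lborel (C i) ^ k / fact k * exp (- measure lborel (C i)))"
        unfolding emeasure_eq_measure using C(2)[OF \<open>i < n\<close>] by (subst unit_poisson_processD(4)[OF X]) auto
      finally show ?thesis .
    qed
    show "emeasure (distr M (count_space UNIV) (\<lambda>\<omega>. card (P \<omega> \<inter> C i))) {k}
      = emeasure (distr M' (count_space UNIV) (\<lambda>\<omega>. card (P' \<omega> \<inter> C i))) {k}"
      unfolding eq[OF P] eq[OF P'] ..
  qed auto
  then have "PiM {..<n} (\<lambda>i. distr M (count_space UNIV) (\<lambda>\<omega>. card (P \<omega> \<inter> C i)))
      = PiM {..<n} (\<lambda>i. distr M' (count_space UNIV) (\<lambda>\<omega>. card (P' \<omega> \<inter> C i)))"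
    by (intro PiM_cong) auto
  then show "emeasure (distr M point_sets P) D = emeasure (distr M' point_sets P') D"
    unfolding *[OF P] *[OF P'] by simp
qed auto

section \<open>Independence over disjoint regions, and volume preserving maps\<close>

text \<open>Both regions may be unbounded. The cells of an event in \<open>K\<close> and of one in
  \<open>K'\<close> are pooled into a single disjoint family; splitting its independent counts into
  two blocks makes the two events independent, and stability under intersection extends this to the
  generated \<sigma>-algebras.\<close>

lemma poisson_indep_restrict:
  fixes E :: "'a::euclidean_space set"
  assumes E: "E \<in> sets borel" and P: "unit_poisson_process M E P"
    and K: "K \<in> sets borel" and K': "K' \<in> sets borel" and KK: "K \<inter> K' = {}"
  shows "prob_space.indep_var M point_sets (\<lambda>\<omega>. P \<omega> \<inter> K) point_sets (\<lambda>\<omega>. P \<omega> \<inter> K')"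
proof -
  interpret prob_space M by (rule unit_poisson_processD[OF P])
  note P' = unit_poisson_processD[OF P]
  have meas: "(\<lambda>\<omega>. P \<omega> \<inter> L) \<in> M \<rightarrow>\<^sub>M point_sets" if "L \<in> sets borel" for L
    using measurable_point_sets_Int[OF P'(2) that] .
  let ?G = "\<lambda>L. {(\<lambda>\<omega>. P \<omega> \<inter> L) -` D \<inter> space M | D. D \<in> count_events}"
  \<comment> \<open>The events determined by the restriction to \<open>L\<close> are generated by
    pulling back the \<pi>-system, so independence can be checked there.\<close>
  have sigma: "sigma_sets (space M) {(\<lambda>\<omega>. P \<omega> \<inter> L) -` D \<inter> space M | D. D \<in> sets point_sets}
      = sigma_sets (space M) (?G L)" if L: "L \<in> sets borel" for L
  proof -
    have "(\<lambda>\<omega>. P \<omega> \<inter> L) \<in> space M \<rightarrow> {S. locally_finite S}"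
      using measurable_space[OF meas[OF L]] by (simp add: space_point_sets)
    from sigma_sets_vimage_commute[OF this, of count_events]
    have "{(\<lambda>\<omega>. P \<omega> \<inter> L) -` D \<inter> space M | D. D \<in> sets point_sets} = sigma_sets (space M) (?G L)"
      by (simp add: sets_point_sets_count_events)
    moreover have "?G L \<subseteq> Pow (space M)" by blast
    ultimately show ?thesis by (simp only: sigma_sets_sigma_sets_eq)
  qed
  have stable: "Int_stable (?G L)" for L
  proof (rule Int_stableI)
    fix a b assume "a \<in> ?G L" "b \<in> ?G L"
    then obtain D D' where "a = (\<lambda>\<omega>. P \<omega> \<inter> L) -` D \<inter> space M" "b = (\<lambda>\<omega>. P \<omega> \<inter> L) -` D' \<inter> space M"
      "D \<in> count_events" "D' \<in> count_events" by blast
    then have "a \<inter> b = (\<lambda>\<omega>. P \<omega> \<inter> L) -` (D \<inter> D') \<inter> space M" "D \<inter> D' \<in> count_events"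
      using Int_stable_count_events by (auto simp: Int_stable_def)
    then show "a \<inter> b \<in> ?G L" by blast
  qed
  have "indep_set (?G K) (?G K')"
  proof (rule indep_setI)
    show "?G K \<subseteq> events" "?G K' \<subseteq> events"
      using meas K K' count_events_subset by (auto intro!: measurable_sets)
    fix a b assume "a \<in> ?G K" "b \<in> ?G K'"
    then obtain D D' where a: "a = (\<lambda>\<omega>. P \<omega> \<inter> K) -` D \<inter> space M"
      and b: "b = (\<lambda>\<omega>. P \<omega> \<inter> K') -` D' \<inter> space M"
      and "D \<in> count_events" "D' \<in> count_events" by blast
    then obtain F F' where D: "D = {S. locally_finite S \<and> (\<forall>(A, n)\<in>F. card (S \<inter> A) = n)}"
      and F: "finite F" "\<forall>(A, n)\<in>F. A \<in> sets borel \<and> bounded A"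
      and D': "D' = {S. locally_finite S \<and> (\<forall>(A, n)\<in>F'. card (S \<inter> A) = n)}"
      and F': "finite F'" "\<forall>(A, n)\<in>F'. A \<in> sets borel \<and> bounded A"
      unfolding count_events_def by blast
    have EK: "E \<inter> K \<in> sets borel" "E \<inter> K' \<in> sets borel" using E K K' by auto
    obtain n :: nat and C Q where C: "0 < n" "disjoint_family_on C {..<n}"
       "\<And>i. i < n \<Longrightarrow> C i \<in> sets borel \<and> bounded (C i) \<and> C i \<subseteq> E \<inter> K"
      and Q: "Q \<in> sets (PiM {..<n} (\<lambda>_. count_space UNIV))"
       "\<And>S. locally_finite S \<Longrightarrow> S \<subseteq> E \<inter> K \<Longrightarrow>
        (\<forall>(A, k)\<in>F. card (S \<inter> A) = k) \<longleftrightarrow> (\<lambda>i\<in>{..<n}. card (S \<inter> C i)) \<in> Q"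
      using count_event_disjoint[OF EK(1) F] by blast
    obtain n' :: nat and C' Q' where C': "0 < n'" "disjoint_family_on C' {..<n'}"
       "\<And>i. i < n' \<Longrightarrow> C' i \<in> sets borel \<and> bounded (C' i) \<and> C' i \<subseteq> E \<inter> K'"
      and Q': "Q' \<in> sets (PiM {..<n'} (\<lambda>_. count_space UNIV))"
       "\<And>S. locally_finite S \<Longrightarrow> S \<subseteq> E \<inter> K' \<Longrightarrow>
        (\<forall>(A, k)\<in>F'. card (S \<inter> A) = k) \<longleftrightarrow> (\<lambda>i\<in>{..<n'}. card (S \<inter> C' i)) \<in> Q'"
      using count_event_disjoint[OF EK(2) F'] by blast
    define B where "B i = (if i < n then C i else C' (i - n))" for i
    let ?X = "\<lambda>i \<omega>. card (P \<omega> \<inter> B i)"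
    let ?c = "\<lambda>_::nat. count_space (UNIV :: nat set)"
    have B: "B i \<in> sets borel \<and> bounded (B i) \<and> B i \<subseteq> E" if "i < n + n'" for i
      using C(3)[of i] C'(3)[of "i - n"] that by (auto simp: B_def)
    have "disjoint_family_on B {..<n + n'}"
      unfolding disjoint_family_on_def
    proof (intro ballI impI)
      fix i j assume ij: "i \<in> {..<n + n'}" "j \<in> {..<n + n'}" "i \<noteq> j"
      have "C i \<inter> C' (j - n) = {} \<and> C' (j - n) \<inter> C i = {}" if "i < n" "n \<le> j" "j < n + n'" for i j
      proof -
        have "j - n < n'" using that by linarith
        then have "C i \<subseteq> K" "C' (j - n) \<subseteq> K'" using C(3)[OF that(1)] C'(3)[of "j - n"] by auto
        then show ?thesis using KK by blast
      qed
      moreover have "C i \<inter> C j = {}" if "i < n" "j < n"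
        using C(2) ij that by (auto simp: disjoint_family_on_def)
      moreover have "C' (i - n) \<inter> C' (j - n) = {}" if "\<not> i < n" "\<not> j < n"
      proof -
        have "i - n \<in> {..<n'}" "j - n \<in> {..<n'}" "i - n \<noteq> j - n" using ij that by auto
        then show ?thesis using C'(2) unfolding disjoint_family_on_def by blast
      qed
      ultimately show "B i \<inter> B j = {}" using ij
        by (cases "i < n"; cases "j < n") (simp_all add: B_def)
    qed
    then have "indep_vars ?c ?X {..<n + n'}"
      using B by (intro P'(5)) auto
    then have ind: "indep_var (PiM {..<n} ?c) (\<lambda>\<omega>. \<lambda>i\<in>{..<n}. ?X i \<omega>)
        (PiM {n..<n + n'} ?c) (\<lambda>\<omega>. \<lambda>i\<in>{n..<n + n'}. ?X i \<omega>)"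
      by (rule indep_var_restrict) auto
    \<comment> \<open>The second block carries indices starting at \<open>n\<close>; it is
      renumbered from \<open>0\<close> to match the cells \<open>C'\<close>.\<close>
    have shift: "(\<lambda>f. \<lambda>i\<in>{..<n'}. f (i + n)) \<in> PiM {n..<n + n'} ?c \<rightarrow>\<^sub>M PiM {..<n'} ?c"
      by (intro measurable_restrict measurable_component_singleton) auto
    have "indep_var (PiM {..<n} ?c) (id \<circ> (\<lambda>\<omega>. \<lambda>i\<in>{..<n}. ?X i \<omega>))
        (PiM {..<n'} ?c) ((\<lambda>f. \<lambda>i\<in>{..<n'}. f (i + n)) \<circ> (\<lambda>\<omega>. \<lambda>i\<in>{n..<n + n'}. ?X i \<omega>))"
      by (rule indep_var_compose[OF ind _ shift]) simp
    moreover have "id \<circ> (\<lambda>\<omega>. \<lambda>i\<in>{..<n}. ?X i \<omega>) = (\<lambda>\<omega>. \<lambda>i\<in>{..<n}. card (P \<omega> \<inter> C i))"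
      by (auto simp: B_def fun_eq_iff)
    moreover have "(\<lambda>f. \<lambda>i\<in>{..<n'}. f (i + n)) \<circ> (\<lambda>\<omega>. \<lambda>i\<in>{n..<n + n'}. ?X i \<omega>)
        = (\<lambda>\<omega>. \<lambda>i\<in>{..<n'}. card (P \<omega> \<inter> C' i))"
      by (auto simp: B_def fun_eq_iff)
    ultimately have ind: "indep_var (PiM {..<n} ?c) (\<lambda>\<omega>. \<lambda>i\<in>{..<n}. card (P \<omega> \<inter> C i))
        (PiM {..<n'} ?c) (\<lambda>\<omega>. \<lambda>i\<in>{..<n'}. card (P \<omega> \<inter> C' i))"
      by simp
    have "a = {\<omega> \<in> space M. (\<lambda>i\<in>{..<n}. card (P \<omega> \<inter> C i)) \<in> Q}"
    proof -
      have "P \<omega> \<inter> K \<in> D \<longleftrightarrow> (\<lambda>i\<in>{..<n}. card (P \<omega> \<inter> C i)) \<in> Q" if \<omega>: "\<omega> \<in> space M" for \<omega>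
      proof -
        have l: "locally_finite (P \<omega> \<inter> K)" "P \<omega> \<inter> K \<subseteq> E \<inter> K"
          using P'(3)[OF \<omega>] locally_finite_value[OF P'(2) \<omega>] by (auto intro: locally_finite_subset)
        have eq: "(\<lambda>i\<in>{..<n}. card (P \<omega> \<inter> K \<inter> C i)) = (\<lambda>i\<in>{..<n}. card (P \<omega> \<inter> C i))"
          using C(3) by (intro restrict_ext arg_cong[where f=card]) auto
        from Q(2)[OF l] l(1) show ?thesis by (simp add: D case_prod_beta eq)
      qed
      then show ?thesis unfolding a by auto
    qed
    moreover have "b = {\<omega> \<in> space M. (\<lambda>i\<in>{..<n'}. card (P \<omega> \<inter> C' i)) \<in> Q'}"
    proof -
      have "P \<omega> \<inter> K' \<in> D' \<longleftrightarrow> (\<lambda>i\<in>{..<n'}. card (P \<omega> \<inter> C' i)) \<in> Q'" if \<omega>: "\<omega> \<in> space M" for \<omega>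
      proof -
        have l: "locally_finite (P \<omega> \<inter> K')" "P \<omega> \<inter> K' \<subseteq> E \<inter> K'"
          using P'(3)[OF \<omega>] locally_finite_value[OF P'(2) \<omega>] by (auto intro: locally_finite_subset)
        have eq: "(\<lambda>i\<in>{..<n'}. card (P \<omega> \<inter> K' \<inter> C' i)) = (\<lambda>i\<in>{..<n'}. card (P \<omega> \<inter> C' i))"
          using C'(3) by (intro restrict_ext arg_cong[where f=card]) auto
        from Q'(2)[OF l] l(1) show ?thesis by (simp add: D' case_prod_beta eq)
      qed
      then show ?thesis unfolding b by auto
    qed
    moreover have "{\<omega> \<in> space M. (\<lambda>i\<in>{..<n}. card (P \<omega> \<inter> C i)) \<in> Q}
        \<inter> {\<omega> \<in> space M. (\<lambda>i\<in>{..<n'}. card (P \<omega> \<inter> C' i)) \<in> Q'}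
      = {\<omega> \<in> space M. (\<lambda>i\<in>{..<n}. card (P \<omega> \<inter> C i)) \<in> Q \<and> (\<lambda>i\<in>{..<n'}. card (P \<omega> \<inter> C' i)) \<in> Q'}"
      by auto
    ultimately show "prob (a \<inter> b) = prob a * prob b"
      using indep_varD[OF ind Q(1) Q'(1)]
      by (simp add: vimage_def Int_def conj_commute)
  qed
  from indep_set_sigma_sets[OF this stable stable] show ?thesis
    unfolding indep_var_eq sigma[OF K] sigma[OF K'] using meas K K' by auto
qed

text \<open>Counts of the image in \<open>A\<close> are counts of \<open>P\<close> in the preimage
  of \<open>A\<close>, which has the same volume and lies in \<open>E\<close> again; disjointness is
  preserved as well. Translations and rotations are the instances.\<close>

lemma unit_poisson_process_image:
  fixes g h :: "'a::euclidean_space \<Rightarrow> 'a"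
  assumes P: "unit_poisson_process M E P"
    and hg: "\<And>x. h (g x) = x" and gh: "\<And>x. g (h x) = x"
    and g: "g \<in> borel_measurable borel"
    and bdd: "\<And>A. bounded A \<Longrightarrow> bounded (h ` A)"
    and E: "\<And>x. g x \<in> E \<longleftrightarrow> x \<in> E"
    and leb: "distr lborel borel g = lborel"
  shows "unit_poisson_process M E (\<lambda>\<omega>. g ` P \<omega>)"
proof -
  note P' = unit_poisson_processD[OF P]
  have inj: "inj g" by (metis hg injI)
  have hA: "h ` A = g -` A" for A by (auto simp: gh) (metis hg image_eqI)
  have "g ` V \<inter> A = g ` (V \<inter> h ` A)" for V A
    unfolding hA by auto
  then have card: "card (g ` V \<inter> A) = card (V \<inter> h ` A)" for V A
    using inj by (simp add: card_image inj_on_subset)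
  have borel: "h ` A \<in> sets borel" if "A \<in> sets borel" for A
    using measurable_sets[OF g that] by (simp add: hA)
  have sub: "h ` A \<subseteq> E" if "A \<subseteq> E" for A
  proof (rule image_subsetI)
    fix x assume "x \<in> A"
    with that show "h x \<in> E" using E[of "h x"] gh[of x] by auto
  qed
  have leb: "measure lborel (h ` A) = measure lborel A" if "A \<in> sets borel" for A
  proof -
    have "measure lborel A = measure (distr lborel borel g) A" by (simp add: leb)
    also have "\<dots> = measure lborel (h ` A)"
      using g that by (subst measure_distr) (auto simp: hA)
    finally show ?thesis ..
  qed
  show ?thesis
    unfolding unit_poisson_process_def random_point_set_def
  proof (intro conjI ballI allI impI)
    show "prob_space M" by fact
    show "(\<lambda>\<omega>. g ` P \<omega>) \<in> M \<rightarrow>\<^sub>M point_sets"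
      by (rule measurable_point_sets_image[OF P'(2) hg gh g bdd])
    show "g ` P \<omega> \<subseteq> E" if "\<omega> \<in> space M" for \<omega>
      using P'(3)[OF that] E by auto
  next
    fix A k assume A: "A \<in> sets borel" "bounded A" "A \<subseteq> E"
    show "measure M {\<omega> \<in> space M. card (g ` P \<omega> \<inter> A) = k}
        = measure lborel A ^ k / fact k * exp (- measure lborel A)"
      unfolding card using P'(4)[OF borel bdd sub] A by (simp add: leb)
  next
    fix I :: "nat set" and A
    assume I: "finite I" "disjoint_family_on A I" "\<forall>i\<in>I. A i \<in> sets borel \<and> bounded (A i) \<and> A i \<subseteq> E"
    have "disjoint_family_on (\<lambda>i. h ` A i) I"
      using I(2) by (auto simp: disjoint_family_on_def hA)
    moreover have "h ` A i \<in> sets borel \<and> bounded (h ` A i) \<and> h ` A i \<subseteq> E" if "i \<in> I" for i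
      using bspec[OF I(3) that] borel[of "A i"] bdd[of "A i"] sub[of "A i"] by simp
    ultimately show "prob_space.indep_vars M (\<lambda>_. count_space UNIV) (\<lambda>i \<omega>. card (g ` P \<omega> \<inter> A i)) I"
      unfolding card by (intro P'(5) I(1))
  qed
qed

section \<open>The parking construction\<close>

lemma balls_meet_iff:
  fixes x y :: "'a::real_normed_vector"
  shows "(+) x ` ball 0 r \<inter> (+) y ` ball 0 r \<noteq> {} \<longleftrightarrow> dist x y < 2 * r"
proof -
  have ball: "(+) z ` ball 0 r = ball z r" for z :: 'a
    using ball_translation[of z 0 r] by simp
  show ?thesis
  proof
    assume "(+) x ` ball 0 r \<inter> (+) y ` ball 0 r \<noteq> {}"
    then obtain z where "dist x z < r" "dist y z < r" by (auto simp: ball)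
    then show "dist x y < 2 * r" using dist_triangle2[of x y z] by linarith
  next
    assume "dist x y < 2 * r"
    then have "midpoint x y \<in> ball x r \<inter> ball y r" by (simp add: dist_midpoint)
    then show "(+) x ` ball 0 r \<inter> (+) y ` ball 0 r \<noteq> {}" unfolding ball by blast
  qed
qed

lemma parking_edge_iff:
  "parking_edge \<rho> p q \<longleftrightarrow> dist (fst p) (fst q) < 2 * \<rho> \<and>
     (snd p < snd q \<or> snd p = snd q \<and> less_fun (($) (fst p)) (($) (fst q)))"
  unfolding parking_edge_def balls_meet_iff ..

text \<open>Different times decide directly; at equal times the positions differ, and the
  lexicographic order is total.\<close>

lemma parking_edge_total:
  assumes "dist (fst p) (fst q) < 2 * \<rho>" "p \<noteq> q"
  shows "parking_edge \<rho> p q \<or> parking_edge \<rho> q p"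
proof (cases "snd p = snd q")
  case False
  with assms show ?thesis by (auto simp: parking_edge_iff dist_commute)
next
  case True
  with assms have "($) (fst p) \<noteq> ($) (fst q)" by (auto simp: prod_eq_iff vec_nth_inject)
  then have "less_fun (($) (fst p)) (($) (fst q)) \<or> less_fun (($) (fst q)) (($) (fst p))"
    using less_fun_trichotomy[of "($) (fst p)" "($) (fst q)"] by auto
  with True assms show ?thesis by (auto simp: parking_edge_iff dist_commute)
qed

lemma parking_rest_antimono: "i \<le> j \<Longrightarrow> parking_rest \<rho> V j \<subseteq> parking_rest \<rho> V i"
  by (induction j rule: dec_induct) auto

lemma parking_rest_subset: "parking_rest \<rho> V i \<subseteq> V"
  using parking_rest_antimono[of 0 i \<rho> V] by simp

lemma parking_roots_subset: "parking_roots \<rho> V \<subseteq> V"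
  by (auto simp: parking_roots_def)

text \<open>Suppose \<open>p\<close> is selected no later than \<open>q\<close>. No edge leads to
  the root \<open>p\<close> from \<open>q\<close>, so one leads from \<open>p\<close> to
  \<open>q\<close>. Hence \<open>q\<close> is not a root of that round, and as an offspring of
  \<open>p\<close> it is absent from all later ones.\<close>

lemma parking_separated:
  assumes p: "p \<in> parking_roots \<rho> (parking_rest \<rho> V i)"
    and q: "q \<in> parking_roots \<rho> (parking_rest \<rho> V j)"
    and dist: "dist (fst p) (fst q) < 2 * \<rho>"
  shows "p = q"
proof -
  have *: "p = q" if p: "p \<in> parking_roots \<rho> (parking_rest \<rho> V i)"
    and q: "q \<in> parking_roots \<rho> (parking_rest \<rho> V j)"
    and dist: "dist (fst p) (fst q) < 2 * \<rho>" and "i \<le> j" for p q i j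
  proof (rule ccontr)
    assume "p \<noteq> q"
    have "q \<in> parking_rest \<rho> V i"
      using q parking_rest_antimono[OF \<open>i \<le> j\<close>, of \<rho> V] parking_roots_subset by blast
    then have "\<not> parking_edge \<rho> q p" using p by (auto simp: parking_roots_def)
    then have e: "parking_edge \<rho> p q" using parking_edge_total[OF dist \<open>p \<noteq> q\<close>] by blast
    show False
    proof (cases "i = j")
      case True
      with e p q show False by (auto simp: parking_roots_def)
    next
      case False
      have "q \<in> parking_offspring \<rho> (parking_rest \<rho> V i)"
        using e p \<open>q \<in> parking_rest \<rho> V i\<close> by (auto simp: parking_offspring_def)
      then have "q \<notin> parking_rest \<rho> V (Suc i)" by simp
      moreover have "q \<in> parking_rest \<rho> V (Suc i)"
      proof (rule subsetD[OF parking_rest_antimono])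
        show "Suc i \<le> j" using False \<open>i \<le> j\<close> by simp
        show "q \<in> parking_rest \<rho> V j" using q parking_roots_subset by blast
      qed
      ultimately show False by blast
    qed
  qed
  show ?thesis
    using *[OF p q dist] *[OF q p] dist by (metis dist_commute linear)
qed

text \<open>Bounded parts are closed by uniform separation, hence compact; each ball of radius
  \<open>e\<close> in a finite cover contains only its centre.\<close>

lemma locally_finite_uniformly_separated:
  fixes S :: "'a::heine_borel set"
  assumes e: "0 < e" and sep: "\<And>x y. x \<in> S \<Longrightarrow> y \<in> S \<Longrightarrow> dist x y < e \<Longrightarrow> x = y"
  shows "locally_finite S"
  unfolding locally_finite_def
proof (intro allI impI)
  fix K :: "'a set" assume "bounded K"
  have "closed (S \<inter> K)"
    by (rule discrete_imp_closed[OF e]) (use sep in auto)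
  then have "compact (S \<inter> K)"
    using \<open>bounded K\<close> by (simp add: compact_eq_bounded_closed bounded_Int)
  from compactE_image[OF this, of "S \<inter> K" "\<lambda>x. ball x e"]
  obtain C where C: "C \<subseteq> S \<inter> K" "finite C" "S \<inter> K \<subseteq> (\<Union>c\<in>C. ball c e)"
    using e by (metis (no_types, lifting) UN_I centre_in_ball open_ball subsetI)
  have "S \<inter> K \<subseteq> C"
  proof
    fix x assume x: "x \<in> S \<inter> K"
    with C(3) obtain c where "c \<in> C" "dist c x < e" by auto
    with sep[of c x] C(1) x show "x \<in> C" by auto
  qed
  with C(2) show "finite (S \<inter> K)" by (rule rev_finite_subset)
qed

lemma inj_on_fst_parking:
  assumes "\<rho> > 0"
  shows "inj_on fst (\<Union>i. parking_roots \<rho> (parking_rest \<rho> V i))"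
  by (rule inj_onI) (use assms parking_separated in fastforce)

lemma locally_finite_parking:
  assumes "\<rho> > 0"
  shows "locally_finite (parking \<rho> V)"
proof (rule locally_finite_uniformly_separated)
  show "0 < 2 * \<rho>" using assms by simp
qed (auto simp: parking_def dest: parking_separated)

lemma parking_subset: "parking \<rho> V \<subseteq> fst ` V"
  unfolding parking_def using parking_rest_subset parking_roots_subset by fast

text \<open>Edges are compared only among points of \<open>V\<close>. This restriction matters for
  rotations, which are compatible with the edges when no two points of \<open>V\<close> share a
  time.\<close>

lemma parking_rest_image:
  assumes inj: "inj_on g V"
    and edge: "\<And>p q. p \<in> V \<Longrightarrow> q \<in> V \<Longrightarrow> parking_edge \<rho> (g p) (g q) \<longleftrightarrow> parking_edge \<rho> p q"
  shows "parking_rest \<rho> (g ` V) i = g ` parking_rest \<rho> V i"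
    and "parking_roots \<rho> (parking_rest \<rho> (g ` V) i) = g ` parking_roots \<rho> (parking_rest \<rho> V i)"
proof -
  have roots: "parking_roots \<rho> (g ` W) = g ` parking_roots \<rho> W" if "W \<subseteq> V" for W
  proof -
    have "(\<exists>p\<in>g ` W. parking_edge \<rho> p (g q)) \<longleftrightarrow> (\<exists>p\<in>W. parking_edge \<rho> p q)" if "q \<in> W" for q
      using edge \<open>W \<subseteq> V\<close> that by blast
    then show ?thesis unfolding parking_roots_def by blast
  qed
  have offspring: "parking_offspring \<rho> (g ` W) = g ` parking_offspring \<rho> W" if "W \<subseteq> V" for W
  proof -
    have "(\<exists>p\<in>g ` parking_roots \<rho> W. parking_edge \<rho> p (g q)) \<longleftrightarrow> (\<exists>p\<in>parking_roots \<rho> W. parking_edge \<rho> p q)"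
      if "q \<in> W" for q
      using edge \<open>W \<subseteq> V\<close> that parking_roots_subset[of \<rho> W] by blast
    then show ?thesis unfolding parking_offspring_def roots[OF that] by blast
  qed
  show rest: "parking_rest \<rho> (g ` V) i = g ` parking_rest \<rho> V i"
  proof (induction i)
    case (Suc i)
    let ?W = "parking_rest \<rho> V i"
    have W: "?W \<subseteq> V" by (rule parking_rest_subset)
    have "parking_roots \<rho> ?W \<union> parking_offspring \<rho> ?W \<subseteq> V"
      using W by (auto simp: parking_roots_def parking_offspring_def)
    then have "g ` (?W - (parking_roots \<rho> ?W \<union> parking_offspring \<rho> ?W))
        = g ` ?W - g ` (parking_roots \<rho> ?W \<union> parking_offspring \<rho> ?W)"
      using W by (intro inj_on_image_set_diff[OF inj]) auto
    then show ?case
      by (simp add: Suc roots[OF W] offspring[OF W] image_Un)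
  qed simp
  show "parking_roots \<rho> (parking_rest \<rho> (g ` V) i) = g ` parking_roots \<rho> (parking_rest \<rho> V i)"
    unfolding rest by (rule roots[OF parking_rest_subset])
qed

lemma parking_image:
  assumes "inj_on g V"
    and "\<And>p q. p \<in> V \<Longrightarrow> q \<in> V \<Longrightarrow> parking_edge \<rho> (g p) (g q) \<longleftrightarrow> parking_edge \<rho> p q"
    and "\<And>p. fst (g p) = f (fst p)"
  shows "parking \<rho> (g ` V) = f ` parking \<rho> V"
  unfolding parking_def parking_rest_image(2)[OF assms(1,2), simplified]
  by (simp add: image_UN image_image assms(3))

section \<open>Measurability of the parking map\<close>

lemma pred_parking_edge:
  "Measurable.pred (borel \<Otimes>\<^sub>M borel) (\<lambda>z. parking_edge \<rho> (fst z) (snd z :: (real ^ 'd::{finite,linorder}) \<times> real))"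
proof -
  let ?B = "borel \<Otimes>\<^sub>M borel :: (((real ^ 'd::{finite,linorder}) \<times> real) \<times> ((real ^ 'd::{finite,linorder}) \<times> real)) measure"
  have [measurable]: "(\<lambda>z. fst (fst z)) \<in> borel_measurable ?B" "(\<lambda>z. fst (snd z)) \<in> borel_measurable ?B"
    "(\<lambda>z. snd (fst z)) \<in> borel_measurable ?B" "(\<lambda>z. snd (snd z)) \<in> borel_measurable ?B"
    unfolding borel_prod by (intro borel_measurable_continuous_onI continuous_intros)+
  have [measurable]: "(\<lambda>z. fst (fst z) $ k) \<in> borel_measurable ?B" "(\<lambda>z. fst (snd z) $ k) \<in> borel_measurable ?B" for k
    unfolding borel_prod by (intro borel_measurable_continuous_onI continuous_intros)+
  \<comment> \<open>The lexicographic comparison unfolds to a finite disjunction over the first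
    coordinate that differs, which reduces measurability to coordinates.\<close>
  have eq: "parking_edge \<rho> p q \<longleftrightarrow> dist (fst p) (fst q) < 2 * \<rho> \<and> (snd p < snd q \<or> snd p = snd q \<and>
      (\<exists>k\<in>UNIV. fst p $ k < fst q $ k \<and> (\<forall>l\<in>{..<k}. fst p $ l = fst q $ l)))" for p q :: "(real ^ 'd::{finite,linorder}) \<times> real"
    by (auto simp: parking_edge_iff less_fun_def)
  show ?thesis
    unfolding eq by measurable
qed

text \<open>The recursion must carry joint measurability in the set and the tested point: each round
  quantifies over points of the set while the tested point is a parameter.\<close>

lemma pred_parking_roots:
  assumes rest: "Measurable.pred (point_sets \<Otimes>\<^sub>M borel)
      (\<lambda>x. snd x \<in> (parking_rest \<rho> (fst x) i :: ((real ^ 'd::{finite,linorder}) \<times> real) set))"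
  shows "Measurable.pred (point_sets \<Otimes>\<^sub>M borel)
      (\<lambda>x. snd x \<in> parking_roots \<rho> (parking_rest \<rho> (fst x) i :: ((real ^ 'd::{finite,linorder}) \<times> real) set))"
    and "Measurable.pred (point_sets \<Otimes>\<^sub>M borel)
      (\<lambda>x. snd x \<in> parking_offspring \<rho> (parking_rest \<rho> (fst x) i :: ((real ^ 'd::{finite,linorder}) \<times> real) set))"
proof -
  let ?N = "point_sets \<Otimes>\<^sub>M borel :: (((real ^ 'd::{finite,linorder}) \<times> real) set \<times> ((real ^ 'd::{finite,linorder}) \<times> real)) measure"
  note compose = measurable_compose[where L="count_space UNIV"]
  have edge: "Measurable.pred (?N \<Otimes>\<^sub>M borel) (\<lambda>y. parking_edge \<rho> (snd y) (snd (fst y)))"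
    using compose[of "\<lambda>y. (snd y, snd (fst y))" "?N \<Otimes>\<^sub>M borel", OF _ pred_parking_edge] by simp
  have rest': "Measurable.pred (?N \<Otimes>\<^sub>M borel) (\<lambda>y. snd y \<in> parking_rest \<rho> (fst (fst y)) i)"
    using compose[of "\<lambda>y. (fst (fst y), snd y)" "?N \<Otimes>\<^sub>M borel", OF _ rest] by simp
  \<comment> \<open>The quantifier runs over the full point set, with membership in the rest moved
    into the condition; this is the shape that \<open>pred_Bex_point_set\<close> covers.\<close>
  have "Measurable.pred ?N (\<lambda>x. \<exists>p\<in>fst x. p \<in> parking_rest \<rho> (fst x) i \<and> parking_edge \<rho> p (snd x))"
    by (rule pred_Bex_point_set) (use edge rest' in simp_all)
  with rest have "Measurable.pred ?N (\<lambda>x. snd x \<in> parking_rest \<rho> (fst x) i \<and>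
      \<not> (\<exists>p\<in>fst x. p \<in> parking_rest \<rho> (fst x) i \<and> parking_edge \<rho> p (snd x)))"
    by (intro pred_intros_logic)
  also have "(\<lambda>x. snd x \<in> parking_rest \<rho> (fst x) i \<and>
      \<not> (\<exists>p\<in>fst x. p \<in> parking_rest \<rho> (fst x) i \<and> parking_edge \<rho> p (snd x)))
    = (\<lambda>x. snd x \<in> parking_roots \<rho> (parking_rest \<rho> (fst x) i))"
    using parking_rest_subset by (fastforce simp: parking_roots_def)
  finally show roots: "Measurable.pred ?N (\<lambda>x. snd x \<in> parking_roots \<rho> (parking_rest \<rho> (fst x) i))" .
  have roots': "Measurable.pred (?N \<Otimes>\<^sub>M borel) (\<lambda>y. snd y \<in> parking_roots \<rho> (parking_rest \<rho> (fst (fst y)) i))"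
    using compose[of "\<lambda>y. (fst (fst y), snd y)" "?N \<Otimes>\<^sub>M borel", OF _ roots] by simp
  have "Measurable.pred ?N (\<lambda>x. \<exists>p\<in>fst x. p \<in> parking_roots \<rho> (parking_rest \<rho> (fst x) i) \<and> parking_edge \<rho> p (snd x))"
    by (rule pred_Bex_point_set) (use edge roots' in simp_all)
  with rest have "Measurable.pred ?N (\<lambda>x. snd x \<in> parking_rest \<rho> (fst x) i \<and>
      (\<exists>p\<in>fst x. p \<in> parking_roots \<rho> (parking_rest \<rho> (fst x) i) \<and> parking_edge \<rho> p (snd x)))"
    by (intro pred_intros_logic)
  also have "(\<lambda>x. snd x \<in> parking_rest \<rho> (fst x) i \<and>
      (\<exists>p\<in>fst x. p \<in> parking_roots \<rho> (parking_rest \<rho> (fst x) i) \<and> parking_edge \<rho> p (snd x)))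
    = (\<lambda>x. snd x \<in> parking_offspring \<rho> (parking_rest \<rho> (fst x) i))"
    using parking_rest_subset parking_roots_subset by (fastforce simp: parking_offspring_def)
  finally show "Measurable.pred ?N (\<lambda>x. snd x \<in> parking_offspring \<rho> (parking_rest \<rho> (fst x) i))" .
qed

lemma pred_parking_rest:
  "Measurable.pred (point_sets \<Otimes>\<^sub>M borel)
    (\<lambda>x. snd x \<in> (parking_rest \<rho> (fst x) i :: ((real ^ 'd::{finite,linorder}) \<times> real) set))"
proof (induction i)
  case 0
  let ?N = "point_sets \<Otimes>\<^sub>M borel :: (((real ^ 'd::{finite,linorder}) \<times> real) set \<times> ((real ^ 'd::{finite,linorder}) \<times> real)) measure"
  have "Measurable.pred ?N (\<lambda>x. \<exists>p\<in>fst x. p = snd x)"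
    by (rule pred_Bex_point_set) measurable
  then show ?case by simp
next
  case (Suc i)
  with pred_parking_roots[OF Suc] show ?case by simp
qed

text \<open>The projection is injective on selected points, so a count of positions is a count of
  space-time points. Finiteness over the cylinder above \<open>A\<close> comes from the separation
  of positions, since a locally finite \<open>V\<close> may have infinitely many points
  there.\<close>

lemma measurable_parking:
  assumes "\<rho> > 0"
  shows "parking \<rho> \<in> measurable point_sets (point_sets :: (real ^ 'd::{finite,linorder}) set measure)"
proof (rule measurable_point_setsI)
  show "locally_finite (parking \<rho> V)" for V by (rule locally_finite_parking[OF assms])
next
  fix A :: "(real ^ 'd::{finite,linorder}) set" assume A: "A \<in> sets borel" "bounded A"
  let ?U = "\<lambda>V. \<Union>i. parking_roots \<rho> (parking_rest \<rho> V i)"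
  have U: "?U V \<subseteq> V" for V
    using parking_roots_subset parking_rest_subset by fast
  have card: "card {p \<in> V. p \<in> ?U V \<and> fst p \<in> A} = card (parking \<rho> V \<inter> A)"
    and fin: "finite {p \<in> V. p \<in> ?U V \<and> fst p \<in> A}" for V
  proof -
    have inj: "inj_on fst {p \<in> V. p \<in> ?U V \<and> fst p \<in> A}"
      using inj_on_fst_parking[OF assms, of V] by (rule inj_on_subset) auto
    have img: "fst ` {p \<in> V. p \<in> ?U V \<and> fst p \<in> A} = parking \<rho> V \<inter> A"
      unfolding parking_def using U[of V] by blast
    show "card {p \<in> V. p \<in> ?U V \<and> fst p \<in> A} = card (parking \<rho> V \<inter> A)"
      using card_image[OF inj] unfolding img by (rule sym)
    show "finite {p \<in> V. p \<in> ?U V \<and> fst p \<in> A}"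
      using locally_finite_finite_Int[OF locally_finite_parking[OF assms] A(2), of V]
      unfolding img[symmetric] by (rule finite_imageD[OF _ inj])
  qed
  have fst: "fst \<in> borel_measurable (borel :: ((real ^ 'd::{finite,linorder}) \<times> real) measure)"
    by (rule borel_measurable_continuous_onI[OF continuous_on_fst[OF continuous_on_id]])
  have "Measurable.pred borel (\<lambda>p :: (real ^ 'd::{finite,linorder}) \<times> real. fst p \<in> A)"
    using fst A(1) by (rule pred_sets2[rotated])
  from measurable_compose[OF measurable_snd this]
  have A': "Measurable.pred (point_sets \<Otimes>\<^sub>M borel)
    (\<lambda>x :: ((real ^ 'd::{finite,linorder}) \<times> real) set \<times> ((real ^ 'd::{finite,linorder}) \<times> real). fst (snd x) \<in> A)" .
  have "Measurable.pred (point_sets \<Otimes>\<^sub>M borel)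
      (\<lambda>x. \<exists>i. snd x \<in> parking_roots \<rho> (parking_rest \<rho> (fst x) i :: ((real ^ 'd::{finite,linorder}) \<times> real) set))"
    by (rule pred_intros_countable) (rule pred_parking_roots(1)[OF pred_parking_rest])
  with A' have "Measurable.pred (point_sets \<Otimes>\<^sub>M borel) (\<lambda>x. snd x \<in> ?U (fst x) \<and> fst (snd x) \<in> A)"
    unfolding UN_iff bex_UNIV by (intro pred_intros_logic)
  then have "(\<lambda>V. card {p \<in> V. p \<in> ?U V \<and> fst p \<in> A}) \<in> measurable point_sets (count_space UNIV)"
    using fin by (intro measurable_card_section[OF measurable_ident_sets[OF refl]])
  then show "(\<lambda>V. card (parking \<rho> V \<inter> A)) \<in> measurable point_sets (count_space UNIV)"
    unfolding card .
qed

section \<open>General position of the points of a Poisson process\<close>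

text \<open>Quantifying over \<open>k\<close>-tuples is quantifying over single points
  \<open>k\<close> times: the last entry moves into an inner quantifier, with the shorter tuple as
  an additional parameter.\<close>

lemma pred_Bex_PiE_point_set:
  assumes S: "S \<in> measurable N point_sets"
    and R: "Measurable.pred (N \<Otimes>\<^sub>M PiM {..<k::nat} (\<lambda>_. borel)) (\<lambda>x. R (fst x) (snd x))"
  shows "Measurable.pred N (\<lambda>\<omega>. \<exists>f\<in>PiE {..<k} (\<lambda>_. S \<omega>). R \<omega> f)"
  using R
proof (induction k arbitrary: R)
  case 0
  have "(\<lambda>\<omega>. (\<omega>, \<lambda>_. undefined)) \<in> N \<rightarrow>\<^sub>M N \<Otimes>\<^sub>M PiM {..<0::nat} (\<lambda>_. borel :: 'b measure)"
    by (intro measurable_Pair measurable_ident_sets[OF refl] measurable_const) (simp add: space_PiM)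
  from measurable_compose[OF this 0] show ?case by simp
next
  case (Suc k)
  let ?P = "\<lambda>k. PiM {..<k} (\<lambda>_. borel :: 'b measure)"
  have [simp]: "insert k {..<k} = {..<Suc k}" by (simp only: lessThan_Suc)
  have "(\<lambda>(f, y). f(k := y)) \<in> ?P k \<Otimes>\<^sub>M borel \<rightarrow>\<^sub>M ?P (Suc k)"
    using measurable_add_dim[of k "{..<k}" "\<lambda>_. borel :: 'b measure"] by simp
  then have "(\<lambda>y. (\<lambda>(f, y). f(k := y)) (snd (fst y), snd y)) \<in> (N \<Otimes>\<^sub>M ?P k) \<Otimes>\<^sub>M borel \<rightarrow>\<^sub>M ?P (Suc k)"
    by (rule measurable_compose[rotated]) simp
  then have "(\<lambda>y. (fst (fst y), (snd (fst y))(k := snd y))) \<in> (N \<Otimes>\<^sub>M ?P k) \<Otimes>\<^sub>M borel \<rightarrow>\<^sub>M N \<Otimes>\<^sub>M ?P (Suc k)"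
    by (intro measurable_Pair) simp_all
  from measurable_compose[OF this Suc.prems]
  have "Measurable.pred ((N \<Otimes>\<^sub>M ?P k) \<Otimes>\<^sub>M borel) (\<lambda>y. R (fst (fst y)) ((snd (fst y))(k := snd y)))"
    by (simp only: fst_conv snd_conv)
  then have "Measurable.pred (N \<Otimes>\<^sub>M ?P k) (\<lambda>x. \<exists>p\<in>S (fst x). R (fst x) ((snd x)(k := p)))"
    using measurable_compose[OF measurable_fst S]
    by (rule pred_Bex_point_set[rotated])
  from Suc.IH[OF this]
  have "Measurable.pred N (\<lambda>\<omega>. \<exists>f\<in>PiE {..<k} (\<lambda>_. S \<omega>). \<exists>p\<in>S \<omega>. R \<omega> (f(k := p)))" .
  also have "(\<lambda>\<omega>. \<exists>f\<in>PiE {..<k} (\<lambda>_. S \<omega>). \<exists>p\<in>S \<omega>. R \<omega> (f(k := p)))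
      = (\<lambda>\<omega>. \<exists>f\<in>PiE {..<Suc k} (\<lambda>_. S \<omega>). R \<omega> f)"
    unfolding lessThan_Suc PiE_insert_eq by (auto simp: fun_eq_iff)
  finally show ?case .
qed

text \<open>Membership in a span quantifies over uncountably many real coefficients. Rational
  coefficients and errors \<open>1 / (real k + 1)\<close> make the quantifiers countable: density
  gives one direction, closedness of the span the other.\<close>

lemma in_span_image_iff_rational_approx:
  fixes w :: "'i \<Rightarrow> 'f::euclidean_space"
  assumes I: "finite I"
  shows "y \<in> span (w ` I) \<longleftrightarrow>
    (\<forall>k::nat. \<exists>u\<in>PiE I (\<lambda>_. \<rat>). norm ((\<Sum>i\<in>I. u i *\<^sub>R w i) - y) < 1 / (real k + 1))"
proof
  assume "y \<in> span (w ` I)"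
  \<comment> \<open>\<open>w\<close> may repeat vectors, so coefficients are found on a subset where
    it is injective and then extended by \<open>0\<close>.\<close>
  obtain J where J: "J \<subseteq> I" "inj_on w J" "w ` I = w ` J"
    using subset_image_inj[of "w ` I" w I] by auto
  have "finite J" using J(1) I by (rule finite_subset)
  with \<open>y \<in> span (w ` I)\<close> obtain c where "y = (\<Sum>v\<in>w ` J. c v *\<^sub>R v)"
    by (auto simp: J(3) span_finite)
  also have "\<dots> = (\<Sum>i\<in>J. c (w i) *\<^sub>R w i)" by (simp add: sum.reindex[OF J(2)])
  also have "\<dots> = (\<Sum>i\<in>I. (if i \<in> J then c (w i) else 0) *\<^sub>R w i)"
    using J(1) I by (intro sum.mono_neutral_cong_left) auto
  finally obtain c where y: "y = (\<Sum>i\<in>I. c i *\<^sub>R w i)" ..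
  have "\<exists>r\<in>\<rat>. c i < r \<and> r < c i + 1 / (real m + 1)" for i and m :: nat
    by (rule Rats_dense_in_real) simp
  then obtain r where r: "\<And>i m. r i m \<in> \<rat>" "\<And>i (m::nat). c i < r i m" "\<And>i m. r i m < c i + 1 / (real m + 1)"
    by metis
  have "(\<lambda>m. r i m) \<longlonglongrightarrow> c i" for i
  proof (rule tendsto_sandwich[of "\<lambda>_. c i" _ _ "\<lambda>m. c i + 1 / (real m + 1)"])
    show "(\<lambda>m. c i + 1 / (real m + 1)) \<longlonglongrightarrow> c i"
      using tendsto_add[OF tendsto_const LIMSEQ_inverse_real_of_nat, of "c i"]
      by (simp add: inverse_eq_divide add.commute)
    show "(\<lambda>m. c i) \<longlonglongrightarrow> c i" by (rule tendsto_const)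
  qed (use r in \<open>auto intro!: always_eventually less_imp_le\<close>)
  then have "(\<lambda>m. norm ((\<Sum>i\<in>I. r i m *\<^sub>R w i) - y)) \<longlonglongrightarrow> norm ((\<Sum>i\<in>I. c i *\<^sub>R w i) - y)"
    by (intro tendsto_intros)
  then have lim: "(\<lambda>m. norm ((\<Sum>i\<in>I. r i m *\<^sub>R w i) - y)) \<longlonglongrightarrow> 0" by (simp add: y)
  show "\<forall>k::nat. \<exists>u\<in>PiE I (\<lambda>_. \<rat>). norm ((\<Sum>i\<in>I. u i *\<^sub>R w i) - y) < 1 / (real k + 1)"
  proof
    fix k :: nat
    have "\<forall>\<^sub>F m in sequentially. norm ((\<Sum>i\<in>I. r i m *\<^sub>R w i) - y) < 1 / (real k + 1)"
      using lim by (rule order_tendstoD) simp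
    then obtain m where m: "norm ((\<Sum>i\<in>I. r i m *\<^sub>R w i) - y) < 1 / (real k + 1)"
      using eventually_happens'[OF sequentially_bot] by blast
    have "(\<lambda>i\<in>I. r i m) \<in> PiE I (\<lambda>_. \<rat>)" using r(1) by auto
    moreover have eq: "(\<Sum>i\<in>I. (\<lambda>i\<in>I. r i m) i *\<^sub>R w i) = (\<Sum>i\<in>I. r i m *\<^sub>R w i)"
      by (intro sum.cong) auto
    have "norm ((\<Sum>i\<in>I. (\<lambda>i\<in>I. r i m) i *\<^sub>R w i) - y) < 1 / (real k + 1)"
      unfolding eq by (rule m)
    ultimately show "\<exists>u\<in>PiE I (\<lambda>_. \<rat>). norm ((\<Sum>i\<in>I. u i *\<^sub>R w i) - y) < 1 / (real k + 1)"
      by (intro bexI[of _ "\<lambda>i\<in>I. r i m"])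
  qed
next
  assume R: "\<forall>k::nat. \<exists>u\<in>PiE I (\<lambda>_. \<rat>). norm ((\<Sum>i\<in>I. u i *\<^sub>R w i) - y) < 1 / (real k + 1)"
  have "y \<in> closure (span (w ` I))"
    unfolding closure_approachable
  proof (intro allI impI)
    fix e :: real assume "0 < e"
    then obtain k :: nat where k: "1 / (real k + 1) < e"
      using reals_Archimedean[of e] by (auto simp: inverse_eq_divide add.commute)
    from R obtain u where "norm ((\<Sum>i\<in>I. u i *\<^sub>R w i) - y) < 1 / (real k + 1)" by blast
    moreover have "(\<Sum>i\<in>I. u i *\<^sub>R w i) \<in> span (w ` I)"
      by (intro span_sum span_scale span_base) auto
    ultimately show "\<exists>z\<in>span (w ` I). dist z y < e" using k by (force simp: dist_norm)
  qed
  then show "y \<in> span (w ` I)" by (simp add: closure_closed closed_span)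
qed

lemma pred_affine_hull:
  fixes \<phi> :: "'a::euclidean_space \<Rightarrow> 'f::euclidean_space"
  assumes \<phi>[measurable]: "\<phi> \<in> borel_measurable borel" and n: "0 < (n::nat)"
  shows "Measurable.pred (PiM {..<n} (\<lambda>_. borel) \<Otimes>\<^sub>M borel)
    (\<lambda>x. \<phi> (snd x) \<in> affine hull ((\<lambda>i. \<phi> (fst x i)) ` {..<n}))"
proof -
  \<comment> \<open>Subtracting the base point \<open>v 0\<close>, available because
    \<open>0 < n\<close>, turns the affine hull into a span.\<close>
  have "y \<in> affine hull (v ` {..<n}) \<longleftrightarrow> y - v 0 \<in> span ((\<lambda>i. v i - v 0) ` {..<n})" for y :: 'f and v
  proof -
    have "v 0 \<in> affine hull (v ` {..<n})" using n by (intro hull_inc) auto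
    from affine_hull_span_gen[OF this]
    have "affine hull (v ` {..<n}) = (+) (v 0) ` span ((\<lambda>i. v i - v 0) ` {..<n})"
      by (simp add: image_image)
    then show ?thesis by (auto intro: image_eqI[of _ _ "y - v 0"])
  qed
  then have eq: "y \<in> affine hull (v ` {..<n}) \<longleftrightarrow> (\<forall>k::nat. \<exists>u\<in>PiE {..<n} (\<lambda>_. \<rat>).
      norm ((\<Sum>i<n. u i *\<^sub>R (v i - v 0)) - (y - v 0)) < 1 / (real k + 1))" for y :: 'f and v
    by (simp add: in_span_image_iff_rational_approx)
  let ?N = "PiM {..<n} (\<lambda>_. borel) \<Otimes>\<^sub>M borel :: ((nat \<Rightarrow> 'a) \<times> 'a) measure"
  have cnt: "countable (PiE {..<n} (\<lambda>_. \<rat> :: real set))"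
    by (intro countable_PiE countable_rat) auto
  have [measurable]: "(\<lambda>x. \<phi> (fst x i)) \<in> borel_measurable ?N" if "i < n" for i
  proof -
    have "(\<lambda>f. f i) \<in> PiM {..<n} (\<lambda>_. borel) \<rightarrow>\<^sub>M (borel :: 'a measure)"
      using that by (intro measurable_component_singleton) simp
    then show ?thesis
      by (intro measurable_compose[OF measurable_compose[OF measurable_fst] \<phi>])
  qed
  have "(\<lambda>x. norm ((\<Sum>i<n. u i *\<^sub>R (\<phi> (fst x i) - \<phi> (fst x 0))) - (\<phi> (snd x) - \<phi> (fst x 0)))) \<in> borel_measurable ?N"
    for u :: "nat \<Rightarrow> real"
    using n by measurable
  then have "Measurable.pred ?N (\<lambda>x. norm ((\<Sum>i<n. u i *\<^sub>R (\<phi> (fst x i) - \<phi> (fst x 0))) - (\<phi> (snd x) - \<phi> (fst x 0))) < 1 / (real k + 1))"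
    for u :: "nat \<Rightarrow> real" and k :: nat
    by measurable
  then show ?thesis
    unfolding eq pred_def by (intro sets.sets_Collect_countable_All sets.sets_Collect_countable_Ex'[OF _ cnt])
qed

section \<open>Null sets and degenerate configurations\<close>

text \<open>On a bounded null set inside \<open>E\<close> the count is \<open>0\<close> with
  probability \<open>0 ^ 0 / fact 0 * exp 0 = 1\<close>; countably many balls exhaust the
  space.\<close>

lemma poisson_avoids_null_set:
  fixes E :: "'a::euclidean_space set"
  assumes E: "E \<in> sets borel" and P: "unit_poisson_process M E P" and N: "N \<in> null_sets lborel"
  shows "AE \<omega> in M. P \<omega> \<inter> N = {}"
proof -
  note P' = unit_poisson_processD[OF P]
  interpret prob_space M by fact
  have "AE \<omega> in M. P \<omega> \<inter> (N \<inter> ball 0 (real k) \<inter> E) = {}" for k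
  proof -
    let ?A = "N \<inter> ball 0 (real k) \<inter> E"
    have A: "?A \<in> sets borel" "bounded ?A" "?A \<subseteq> E"
      using N E by (auto intro: bounded_subset)
    have "?A \<in> null_sets lborel"
      using N A(1) by (intro null_sets_subset[OF N]) auto
    then have "measure lborel ?A = 0" by (simp add: measure_def null_sets_def)
    then have "prob {\<omega> \<in> space M. card (P \<omega> \<inter> ?A) = 0} = 1"
      using P'(4)[OF A, of 0] by simp
    from AE_prob_1[OF this] have "AE \<omega> in M. card (P \<omega> \<inter> ?A) = 0" by simp
    then show ?thesis
      using AE_space
    proof eventually_elim
      case (elim \<omega>)
      then show ?case
        using locally_finite_finite_Int[OF locally_finite_value[OF P'(2) elim(2)] A(2)] by simp
    qed
  qed
  then have "AE \<omega> in M. \<forall>k. P \<omega> \<inter> (N \<inter> ball 0 (real k) \<inter> E) = {}"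
    by (simp add: AE_all_countable)
  then show ?thesis
    using AE_space
  proof eventually_elim
    case (elim \<omega>)
    show ?case
    proof (rule ccontr)
      assume "P \<omega> \<inter> N \<noteq> {}"
      then obtain x where x: "x \<in> P \<omega>" "x \<in> N" by auto
      obtain k where "norm x < real k" using reals_Archimedean2 by blast
      with elim x P'(3) show False by fastforce
    qed
  qed
qed

lemma countable_locally_finite:
  fixes S :: "'a::euclidean_space set"
  assumes "locally_finite S" shows "countable S"
proof -
  have "countable (\<Union>k. S \<inter> ball 0 (real k))"
    using locally_finite_finite_Int[OF assms bounded_ball] by (intro countable_UN) (auto intro: countable_finite)
  also have "(\<Union>k. S \<inter> ball 0 (real k)) = S"
    by (auto simp: reals_Archimedean2)
  finally show ?thesis .
qed

text \<open>At most \<open>DIM('f)\<close> points have an affine hull of dimension below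
  \<open>DIM('f)\<close>, hence one inside a hyperplane, whose preimage is null by
  assumption.\<close>

lemma null_sets_preimage_affine_hull:
  fixes \<phi> :: "'a::euclidean_space \<Rightarrow> 'f::euclidean_space"
  assumes \<phi>: "\<phi> \<in> borel_measurable borel"
    and null: "\<And>a b. a \<noteq> 0 \<Longrightarrow> {x. a \<bullet> \<phi> x = b} \<in> null_sets lborel"
    and T: "finite T" "card T \<le> DIM('f)"
  shows "{x. \<phi> x \<in> affine hull T} \<in> null_sets lborel"
proof -
  have "aff_dim (affine hull T) < DIM('f)"
    using aff_dim_le_card[OF T(1)] T(2) by simp
  then obtain a b where ab: "a \<noteq> 0" "affine hull T \<subseteq> {x. a \<bullet> x = b}"
    by (rule aff_lowdim_subset_hyperplane)
  have "{x. \<phi> x \<in> affine hull T} = \<phi> -` (affine hull T) \<inter> space borel" by auto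
  also have "\<dots> \<in> sets borel"
    using \<phi> by (rule measurable_sets) (simp add: borel_closed closed_affine_hull)
  finally show ?thesis
    using ab(2) by (intro null_sets_subset[OF null[OF ab(1), of b]]) auto
qed

text \<open>One point is singled out against the others, so that its independence of them can be
  exploited. The bound \<open>DIM('f)\<close> is what guarantees that the hull lies in a hyperplane.
  Singletons \<open>Q\<close> make \<open>\<phi>\<close> injective on \<open>V\<close>.\<close>

definition in_general_position :: "('a \<Rightarrow> 'f::euclidean_space) \<Rightarrow> 'a set \<Rightarrow> bool" where
  "in_general_position \<phi> V \<longleftrightarrow>
    (\<forall>q\<in>V. \<forall>Q\<subseteq>V - {q}. finite Q \<longrightarrow> card Q \<le> DIM('f) \<longrightarrow> \<phi> q \<notin> affine hull (\<phi> ` Q))"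

text \<open>
  A point of the process in a set \<open>C\<close> is independent of the points outside \<open>C\<close>, so it avoids the
  null set of positions that are degenerate relative to those. Letting \<open>C\<close> range over a countable
  base isolates each point from any finitely many others.
\<close>

lemma poisson_general_position:
  fixes \<phi> :: "'a::euclidean_space \<Rightarrow> 'f::euclidean_space"
  assumes E: "E \<in> sets borel" and P: "unit_poisson_process M E P"
    and \<phi>: "\<phi> \<in> borel_measurable borel"
    and null: "\<And>a b. a \<noteq> 0 \<Longrightarrow> {x. a \<bullet> \<phi> x = b} \<in> null_sets lborel"
  shows "AE \<omega> in M. in_general_position \<phi> (P \<omega>)"
proof -
  note P' = unit_poisson_processD[OF P]
  interpret prob_space M by fact
  define n where "n = DIM('f)"
  have n: "0 < n" by (simp add: n_def)
  define R where "R f q \<longleftrightarrow> \<phi> q \<in> affine hull ((\<lambda>i. \<phi> (f i)) ` {..<n})" for f q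
  have R: "Measurable.pred (PiM {..<n} (\<lambda>_. borel) \<Otimes>\<^sub>M borel) (\<lambda>x. R (fst x) (snd x))"
    unfolding R_def by (rule pred_affine_hull[OF \<phi> n])
  let ?pp = "point_sets \<Otimes>\<^sub>M point_sets :: ('a set \<times> 'a set) measure"
  have "(\<lambda>y. (snd y, snd (fst y))) \<in> (?pp \<Otimes>\<^sub>M borel) \<Otimes>\<^sub>M PiM {..<n} (\<lambda>_. borel)
      \<rightarrow>\<^sub>M PiM {..<n} (\<lambda>_. borel) \<Otimes>\<^sub>M (borel :: 'a measure)"
    by measurable
  from measurable_compose[OF this R]
  have "Measurable.pred ((?pp \<Otimes>\<^sub>M borel) \<Otimes>\<^sub>M PiM {..<n} (\<lambda>_. borel)) (\<lambda>y. R (snd y) (snd (fst y)))"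
    by simp
  from pred_Bex_PiE_point_set[OF _ this, of "\<lambda>x. fst (fst x)"]
  have "Measurable.pred (?pp \<Otimes>\<^sub>M borel) (\<lambda>x. \<exists>f\<in>PiE {..<n} (\<lambda>_. fst (fst x)). R f (snd x))"
    by simp
  from pred_Bex_point_set[OF _ this, of snd]
  have bad: "Measurable.pred ?pp (\<lambda>x. \<exists>q\<in>snd x. \<exists>f\<in>PiE {..<n} (\<lambda>_. fst x). R f q)"
    by simp
  have sep: "AE \<omega> in M. \<forall>q\<in>P \<omega> \<inter> C. \<forall>f\<in>PiE {..<n} (\<lambda>_. P \<omega> \<inter> - C). \<not> R f q"
    if C: "C \<in> sets borel" for C
  proof -
    have meas: "(\<lambda>\<omega>. P \<omega> \<inter> L) \<in> M \<rightarrow>\<^sub>M point_sets" if "L \<in> sets borel" for L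
      using measurable_point_sets_Int[OF P'(2) that] .
    have C': "- C \<in> sets borel" using C by auto
    let ?X = "distr M point_sets (\<lambda>\<omega>. P \<omega> \<inter> - C)" and ?Y = "distr M point_sets (\<lambda>\<omega>. P \<omega> \<inter> C)"
    interpret X: prob_space ?X by (rule prob_space_distr[OF meas[OF C']])
    interpret Y: prob_space ?Y by (rule prob_space_distr[OF meas[OF C]])
    interpret XY: pair_prob_space ?X ?Y ..
    \<comment> \<open>Independence of the two restrictions makes their joint law a product, so the
      bad event can be examined with the points outside \<open>C\<close> frozen.\<close>
    have joint: "?X \<Otimes>\<^sub>M ?Y = distr M ?pp (\<lambda>\<omega>. (P \<omega> \<inter> - C, P \<omega> \<inter> C))"
      using poisson_indep_restrict[OF E P C' C] unfolding indep_var_distribution_eq by auto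
    let ?G = "\<lambda>x. \<not> (\<exists>q\<in>snd x. \<exists>f\<in>PiE {..<n} (\<lambda>_. fst x). R f q)"
    have sets: "{x \<in> space ?pp. ?G x} \<in> sets ?pp"
      using bad by (intro predE pred_intros_logic)
    have "AE S in ?X. AE T in ?Y. ?G (S, T)"
    proof (rule AE_I2)
      fix S assume "S \<in> space ?X"
      then have "countable S" by (auto simp: space_point_sets intro: countable_locally_finite)
      \<comment> \<open>A frozen \<open>S\<close> is countable and has only countably many
        \<open>n\<close>-tuples, so the union of their degenerate sets is still null.\<close>
      have "(\<Union>f\<in>PiE {..<n} (\<lambda>_. S). {q. R f q}) \<in> null_sets lborel"
      proof (rule null_sets_UN')
        show "countable (PiE {..<n} (\<lambda>_. S))" by (intro countable_PiE \<open>countable S\<close>) auto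
        have "card ((\<lambda>i. \<phi> (f i)) ` {..<n}) \<le> DIM('f)" for f :: "nat \<Rightarrow> 'a"
          using card_image_le[of "{..<n}" "\<lambda>i. \<phi> (f i)"] by (simp add: n_def)
        then show "{q. R f q} \<in> null_sets lborel" for f
          unfolding R_def by (intro null_sets_preimage_affine_hull \<phi> null) auto
      qed
      from poisson_avoids_null_set[OF E P this]
      have "AE \<omega> in M. ?G (S, P \<omega> \<inter> C)" by eventually_elim auto
      moreover have "{T \<in> space point_sets. ?G (S, T)} \<in> sets point_sets"
      proof -
        have "(\<lambda>T. (S, T)) \<in> point_sets \<rightarrow>\<^sub>M ?pp"
          using \<open>S \<in> space ?X\<close> by simp
        from measurable_compose[OF this bad] show ?thesis
          by (intro predE pred_intros_logic) simp
      qed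
      ultimately show "AE T in ?Y. ?G (S, T)"
        by (simp add: AE_distr_iff[OF meas[OF C]])
    qed
    moreover have "{x \<in> space (?X \<Otimes>\<^sub>M ?Y). ?G x} \<in> sets (?X \<Otimes>\<^sub>M ?Y)"
      using sets by (simp only: joint sets_distr space_distr)
    ultimately have "AE x in ?X \<Otimes>\<^sub>M ?Y. ?G x"
      by (intro XY.AE_pair_measure)
    then have "AE \<omega> in M. ?G (P \<omega> \<inter> - C, P \<omega> \<inter> C)"
      unfolding joint using meas[OF C] meas[OF C'] by (subst (asm) AE_distr_iff[OF _ sets]) auto
    then show ?thesis by simp
  qed
  obtain \<B> :: "'a set set" where \<B>: "countable \<B>" "topological_basis \<B>"
    using ex_countable_basis by blast
  have "AE \<omega> in M. \<forall>C\<in>\<B>. \<forall>q\<in>P \<omega> \<inter> C. \<forall>f\<in>PiE {..<n} (\<lambda>_. P \<omega> \<inter> - C). \<not> R f q"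
    using sep topological_basis_open[OF \<B>(2)] by (simp add: AE_ball_countable[OF \<B>(1)])
  then show ?thesis
  proof eventually_elim
    case (elim \<omega>)
    show ?case
      unfolding in_general_position_def
    proof (intro ballI allI impI notI)
      fix q Q assume q: "q \<in> P \<omega>" and Q: "Q \<subseteq> P \<omega> - {q}" "finite Q" "card Q \<le> DIM('f)"
        and hull: "\<phi> q \<in> affine hull (\<phi> ` Q)"
      from hull have "Q \<noteq> {}" by auto
      have "open (- Q)" using Q(2) by (simp add: finite_imp_closed open_Compl)
      moreover have "q \<in> - Q" using Q(1) by auto
      ultimately obtain C where C: "C \<in> \<B>" "q \<in> C" "C \<subseteq> - Q"
        using topological_basisE[OF \<B>(2)] by metis
      obtain h where h: "bij_betw h {..<card Q} Q"
        using ex_bij_betw_nat_finite[OF Q(2)] by (auto simp: atLeast0LessThan)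
      \<comment> \<open>\<open>Q\<close> may have fewer than \<open>n\<close> points; repeating
        \<open>h 0\<close> pads the tuple to length \<open>n\<close> without changing its
        range.\<close>
      define f where "f = (\<lambda>i\<in>{..<n}. if i < card Q then h i else h 0)"
      have Q0: "0 < card Q" using \<open>Q \<noteq> {}\<close> Q(2) by (simp add: card_gt_0_iff)
      have im: "f ` {..<n} = Q"
      proof
        show "f ` {..<n} \<subseteq> Q" using h Q0 by (auto simp: f_def bij_betw_def)
        show "Q \<subseteq> f ` {..<n}"
        proof
          fix p assume "p \<in> Q"
          then obtain i where "i < card Q" "p = h i" using h by (auto simp: bij_betw_def)
          then show "p \<in> f ` {..<n}" using Q(3) by (auto simp: f_def n_def intro!: image_eqI[of _ _ i])
        qed
      qed
      have "f \<in> PiE {..<n} (\<lambda>_. P \<omega> \<inter> - C)"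
        using im Q(1) C(3) by (auto simp: f_def PiE_iff)
      with elim C q have "\<not> R f q" by blast
      moreover have "(\<lambda>i. \<phi> (f i)) ` {..<n} = \<phi> ` Q" using im by auto
      ultimately show False using hull by (simp add: R_def)
    qed
  qed
qed

text \<open>A hyperplane has affine dimension \<open>DIM('f) - 1\<close>, so
  \<open>DIM('f) + 1\<close> points in it are affinely dependent, and one of them lies in the hull
  of the \<open>DIM('f)\<close> others.\<close>

lemma general_position_not_in_hyperplane:
  fixes \<phi> :: "'a \<Rightarrow> 'f::euclidean_space"
  assumes gp: "in_general_position \<phi> V"
    and Q: "Q \<subseteq> V" "finite Q" "card Q = DIM('f) + 1" and a: "a \<noteq> 0"
  shows "\<not> \<phi> ` Q \<subseteq> {x. a \<bullet> x = b}"
proof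
  assume sub: "\<phi> ` Q \<subseteq> {x. a \<bullet> x = b}"
  \<comment> \<open>Coincident images would spoil the dimension count; the singleton case of general
    position excludes them.\<close>
  have inj: "inj_on \<phi> Q"
  proof (rule inj_onI, rule ccontr)
    fix p q assume pq: "p \<in> Q" "q \<in> Q" "\<phi> p = \<phi> q" "p \<noteq> q"
    then have "{p} \<subseteq> V - {q}" "q \<in> V" using Q by auto
    moreover have "finite {p}" "card {p} \<le> DIM('f)" using DIM_ge_Suc0[where 'a='f] by simp_all
    ultimately have "\<phi> q \<notin> affine hull (\<phi> ` {p})"
      using gp unfolding in_general_position_def by blast
    with pq show False by simp
  qed
  have "aff_dim (\<phi> ` Q) \<le> aff_dim {x. a \<bullet> x = b}" by (rule aff_dim_subset[OF sub])
  also have "\<dots> = int DIM('f) - 1" using a by (simp add: aff_dim_hyperplane)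
  finally have "affine_dependent (\<phi> ` Q)"
    using affine_independent_iff_card[of "\<phi> ` Q"] card_image[OF inj] Q by auto
  then obtain q where q: "q \<in> Q" "\<phi> q \<in> affine hull (\<phi> ` Q - {\<phi> q})"
    unfolding affine_dependent_def by auto
  have "\<phi> ` Q - {\<phi> q} = \<phi> ` (Q - {q})"
    using inj q(1) by (auto dest: inj_onD)
  with q have "\<phi> q \<in> affine hull (\<phi> ` (Q - {q}))" by simp
  moreover have "Q - {q} \<subseteq> V - {q}" "q \<in> V" "card (Q - {q}) \<le> DIM('f)" "finite (Q - {q})" using Q q(1) by auto
  ultimately show False using gp unfolding in_general_position_def by blast
qed

section \<open>Ergodicity\<close>

lemma (in finite_measure) measure_diff_le_sym_diff:
  assumes "A \<in> sets M" "B \<in> sets M"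
  shows "\<bar>measure M A - measure M B\<bar> \<le> measure M (sym_diff A B)"
proof -
  have "measure M A \<le> measure M (B \<union> sym_diff A B)" "measure M B \<le> measure M (A \<union> sym_diff A B)"
    using assms by (auto intro!: finite_measure_mono)
  then show ?thesis
    using measure_Un_le[of B M "sym_diff A B"] measure_Un_le[of A M "sym_diff A B"] assms
    by (auto simp: abs_le_iff)
qed

text \<open>Induction over the generation of \<open>A\<close>: a generator depends on its own
  bounded set, a complement keeps the window, and a countable union is cut to finitely many terms
  whose windows are united.\<close>

lemma point_sets_event_approx:
  fixes \<mu> :: "'a::euclidean_space set measure"
  assumes \<mu>: "prob_space \<mu>" "sets \<mu> = sets point_sets" and A: "A \<in> sets point_sets" and "0 < \<epsilon>"
  shows "\<exists>D\<in>sets point_sets. \<exists>K\<in>sets borel. bounded K \<and>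
    (\<forall>V. locally_finite V \<longrightarrow> (V \<in> D \<longleftrightarrow> V \<inter> K \<in> D)) \<and> measure \<mu> (sym_diff A D) < \<epsilon>"
proof -
  interpret prob_space \<mu> by fact
  have A': "A \<in> sigma_sets {S. locally_finite S}
      {{S :: 'a set. locally_finite S \<and> card (S \<inter> A) = n} | A n. A \<in> sets borel \<and> bounded A}"
    using A by (simp add: sets_point_sets)
  have events: "sigma_sets {S. locally_finite S}
      {{S :: 'a set. locally_finite S \<and> card (S \<inter> A) = n} | A n. A \<in> sets borel \<and> bounded A} = sets point_sets"
    by (simp add: sets_point_sets)
  show ?thesis
    using A' \<open>0 < \<epsilon>\<close>
  proof (induction A arbitrary: \<epsilon> rule: sigma_sets.induct)
    case (Basic X)
    then obtain B n where X: "X = {S :: 'a set. locally_finite S \<and> card (S \<inter> B) = n}"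
      and B: "B \<in> sets borel" "bounded B" by blast
    have "X \<in> sets point_sets" using Basic(1) unfolding sets_point_sets by (rule sigma_sets.Basic)
    moreover have "\<forall>V. locally_finite V \<longrightarrow> (V \<in> X \<longleftrightarrow> V \<inter> B \<in> X)"
      by (auto simp: X Int_assoc intro: locally_finite_subset)
    ultimately show ?case using B Basic(2) by (intro bexI[of _ X] bexI[of _ B]) auto
  next
    case Empty
    then show ?case by (intro bexI[of _ "{}"]) auto
  next
    case (Compl X)
    from Compl.IH[OF Compl.prems] obtain D K where D: "D \<in> sets point_sets" and K: "K \<in> sets borel" "bounded K"
      and DK: "\<And>V. locally_finite V \<Longrightarrow> V \<in> D \<longleftrightarrow> V \<inter> K \<in> D" and m: "measure \<mu> (sym_diff X D) < \<epsilon>"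
      by blast
    let ?L = "{S :: 'a set. locally_finite S}"
    have sub: "X \<subseteq> ?L" "D \<subseteq> ?L"
      using Compl.hyps D sets.sets_into_space[of X point_sets] sets.sets_into_space[of D point_sets]
      unfolding events by (simp_all add: space_point_sets)
    have "?L - D \<in> sets point_sets"
      using sets.compl_sets[OF D] by (simp add: space_point_sets)
    moreover have "sym_diff (?L - X) (?L - D) = sym_diff X D" using sub by auto
    moreover have "\<forall>V. locally_finite V \<longrightarrow> (V \<in> ?L - D \<longleftrightarrow> V \<inter> K \<in> ?L - D)"
      using DK by (auto intro: locally_finite_subset)
    ultimately show ?case using K m by (intro bexI[of _ "?L - D"] bexI[of _ K]) auto
  next
    case (Union X)
    have X: "X i \<in> sets point_sets" for i using Union.hyps unfolding events .
    let ?B = "\<lambda>N. \<Union>i<N. X i"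
    have "(\<lambda>N. measure \<mu> (?B N)) \<longlonglongrightarrow> measure \<mu> (\<Union>N. ?B N)"
      using X by (intro finite_Lim_measure_incseq) (auto simp: \<mu>(2) incseq_def intro: order_less_le_trans)
    also have "(\<Union>N. ?B N) = (\<Union>i. X i)" by auto
    finally have "\<forall>\<^sub>F N in sequentially. measure \<mu> (\<Union>i. X i) - \<epsilon> / 2 < measure \<mu> (?B N)"
      using Union.prems by (intro order_tendstoD) auto
    then obtain N where N: "measure \<mu> (\<Union>i. X i) - \<epsilon> / 2 < measure \<mu> (?B N)"
      using eventually_happens'[OF sequentially_bot] by blast
    \<comment> \<open>Half of \<open>\<epsilon>\<close> pays for the truncation, and the
      \<open>N\<close> single errors add up to at most the other half. The \<open>+ 1\<close> keeps
      the divisor nonzero for \<open>N = 0\<close>.\<close>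
    let ?\<delta> = "\<epsilon> / (2 * (real N + 1))"
    have "0 < ?\<delta>" using Union.prems by simp
    from Union.IH[OF this] obtain D K where D: "\<And>i. D i \<in> sets point_sets"
      and K: "\<And>i. K i \<in> sets borel" "\<And>i. bounded (K i)"
      and DK: "\<And>i V. locally_finite V \<Longrightarrow> V \<in> D i \<longleftrightarrow> V \<inter> K i \<in> D i"
      and m: "\<And>i. measure \<mu> (sym_diff (X i) (D i)) < ?\<delta>"
      by metis
    let ?D = "\<Union>i<N. D i" and ?K = "\<Union>i<N. K i"
    have "V \<in> D i \<longleftrightarrow> V \<inter> ?K \<in> D i" if V: "locally_finite V" and i: "i < N" for V i
    proof -
      have "V \<inter> ?K \<inter> K i = V \<inter> K i" using i by auto
      moreover have "locally_finite (V \<inter> ?K)" using V by (rule locally_finite_subset) auto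
      ultimately show ?thesis using DK[OF V, of i] DK[of "V \<inter> ?K" i] by simp
    qed
    then have "\<forall>V. locally_finite V \<longrightarrow> (V \<in> ?D \<longleftrightarrow> V \<inter> ?K \<in> ?D)" by auto
    moreover have "?D \<in> sets point_sets" "?K \<in> sets borel" "bounded ?K" using D K by auto
    moreover have "measure \<mu> (sym_diff (\<Union>i. X i) ?D) < \<epsilon>"
    proof -
      have "measure \<mu> ((\<Union>i. X i) - ?B N) = measure \<mu> (\<Union>i. X i) - measure \<mu> (?B N)"
        using X by (intro finite_measure_Diff) (auto simp: \<mu>(2))
      then have 1: "measure \<mu> ((\<Union>i. X i) - ?B N) < \<epsilon> / 2" using N by simp
      have "measure \<mu> (\<Union>i<N. sym_diff (X i) (D i)) \<le> (\<Sum>i<N. measure \<mu> (sym_diff (X i) (D i)))"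
        using X D by (intro finite_measure_subadditive_finite) (auto simp: \<mu>(2))
      also have "\<dots> \<le> (\<Sum>i<N. ?\<delta>)" using m by (intro sum_mono less_imp_le)
      also have "\<dots> \<le> \<epsilon> / 2" using Union.prems by (simp add: field_simps)
      finally have 2: "measure \<mu> (\<Union>i<N. sym_diff (X i) (D i)) \<le> \<epsilon> / 2" .
      have "measure \<mu> (sym_diff (\<Union>i. X i) ?D)
          \<le> measure \<mu> (((\<Union>i. X i) - ?B N) \<union> (\<Union>i<N. sym_diff (X i) (D i)))"
        using X D by (intro finite_measure_mono) (auto simp: \<mu>(2))
      also have "\<dots> \<le> measure \<mu> ((\<Union>i. X i) - ?B N) + measure \<mu> (\<Union>i<N. sym_diff (X i) (D i))"
        using X D by (intro measure_Un_le) (auto simp: \<mu>(2))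
      finally show ?thesis using 1 2 by simp
    qed
    ultimately show ?case by (intro bexI[of _ ?D] bexI[of _ ?K]) blast+
  qed
qed

lemma unit_poisson_process_translation:
  fixes v :: "'a::euclidean_space"
  assumes P: "unit_poisson_process M E P" and E: "\<And>x. v + x \<in> E \<longleftrightarrow> x \<in> E"
  shows "unit_poisson_process M E (\<lambda>\<omega>. (+) v ` P \<omega>)"
proof (rule unit_poisson_process_image[OF P, of "(+) (- v)"])
  show "bounded ((+) (- v) ` A)" if "bounded A" for A
    using that by (rule bounded_translation)
qed (simp_all add: E lborel_distr_plus)

text \<open>A mixing argument: with \<open>p\<close> the probability of the event, comparing it with
  two far apart copies of an approximation yields \<open>p = p\<^sup>2\<close>. The hypothesis
  \<open>far\<close> asks for arbitrarily long translations rather than all, because those that move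
  time do not preserve the space-time region.\<close>

lemma poisson_invariant_event_trivial:
  fixes E :: "'a::euclidean_space set"
  assumes E: "E \<in> sets borel" and P: "unit_poisson_process M E P" and A: "A \<in> sets point_sets"
    and far: "\<And>r. \<exists>v. r < norm v \<and> (\<forall>x. v + x \<in> E \<longleftrightarrow> x \<in> E) \<and>
      (\<forall>V. locally_finite V \<longrightarrow> ((+) v ` V \<in> A \<longleftrightarrow> V \<in> A))"
  shows "measure M {\<omega> \<in> space M. P \<omega> \<in> A} \<in> {0, 1}"
proof -
  note P' = unit_poisson_processD[OF P]
  interpret prob_space M by fact
  let ?\<mu> = "distr M point_sets P"
  let ?p = "prob {\<omega> \<in> space M. P \<omega> \<in> A}"
  have \<mu>: "prob_space ?\<mu>" by (rule prob_space_distr[OF P'(2)])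
  \<comment> \<open>Comparing the event with the intersection of both approximations costs
    \<open>2 * \<epsilon>\<close>; replacing the squared probability of the approximation by that of
    the event costs another \<open>2 * \<epsilon>\<close>.\<close>
  have *: "\<bar>?p - ?p\<^sup>2\<bar> \<le> 4 * \<epsilon>" if \<epsilon>: "0 < \<epsilon>" for \<epsilon>
  proof -
    obtain D K where D: "D \<in> sets point_sets" and K: "K \<in> sets borel" "bounded K"
      and DK: "\<And>V. locally_finite V \<Longrightarrow> V \<in> D \<longleftrightarrow> V \<inter> K \<in> D"
      and m: "measure ?\<mu> (sym_diff A D) < \<epsilon>"
      using point_sets_event_approx[OF \<mu> _ A \<epsilon>] by auto
    obtain r where r: "\<And>x. x \<in> K \<Longrightarrow> norm x \<le> r" using K(2) unfolding bounded_iff by blast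
    \<comment> \<open>As \<open>K\<close> lies in the ball of radius \<open>r\<close>, a shift
      longer than \<open>2 * r\<close> separates it from its translate.\<close>
    obtain v where v: "2 * r < norm v" "\<And>x. v + x \<in> E \<longleftrightarrow> x \<in> E"
      "\<And>V. locally_finite V \<Longrightarrow> (+) v ` V \<in> A \<longleftrightarrow> V \<in> A"
      using far[of "2 * r"] by blast
    let ?Q = "\<lambda>\<omega>. (+) v ` P \<omega>"
    have Q: "unit_poisson_process M E ?Q" by (rule unit_poisson_process_translation[OF P v(2)])
    note Q' = unit_poisson_processD[OF Q]
    have law: "prob {\<omega> \<in> space M. ?Q \<omega> \<in> B} = measure ?\<mu> B" "prob {\<omega> \<in> space M. P \<omega> \<in> B} = measure ?\<mu> B"
      if "B \<in> sets point_sets" for B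
    proof -
      have "prob {\<omega> \<in> space M. X \<omega> \<in> B} = measure (distr M point_sets X) B"
        if "X \<in> M \<rightarrow>\<^sub>M point_sets" for X
        using measure_distr[OF that \<open>B \<in> sets point_sets\<close>] by (simp add: vimage_def Int_def conj_commute)
      then show "prob {\<omega> \<in> space M. ?Q \<omega> \<in> B} = measure ?\<mu> B" "prob {\<omega> \<in> space M. P \<omega> \<in> B} = measure ?\<mu> B"
        using P'(2) Q'(2) poisson_law_unique[OF E Q P] by simp_all
    qed
    have ev: "{\<omega> \<in> space M. X \<omega> \<in> B} \<in> events" if "B \<in> sets point_sets" "X \<in> M \<rightarrow>\<^sub>M point_sets" for B X
      using measurable_sets[OF that(2,1)] by (simp add: vimage_def Int_def conj_commute)
    let ?G = "{\<omega> \<in> space M. P \<omega> \<in> A}" and ?F = "{\<omega> \<in> space M. P \<omega> \<in> D}"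
      and ?F' = "{\<omega> \<in> space M. ?Q \<omega> \<in> D}"
    have G: "?G = {\<omega> \<in> space M. ?Q \<omega> \<in> A}"
      using v(3) locally_finite_value[OF P'(2)] by auto
    have "sym_diff A D \<in> sets point_sets" using A D by auto
    note law' = law[OF this]
    have "sym_diff ?G ?F = {\<omega> \<in> space M. P \<omega> \<in> sym_diff A D}" by auto
    then have m1: "prob (sym_diff ?G ?F) < \<epsilon>" using m law'(2) by simp
    have "sym_diff ?G ?F' = {\<omega> \<in> space M. ?Q \<omega> \<in> sym_diff A D}" unfolding G by auto
    then have m2: "prob (sym_diff ?G ?F') < \<epsilon>" using m law'(1) by simp
    note evs = ev[OF A P'(2)] ev[OF D P'(2)] ev[OF D Q'(2)]
    let ?K = "(+) (- v) ` K"
    have K'eq: "?K = (+) v -` K"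
      by (auto simp: image_iff) (metis add.commute add_diff_cancel_left' diff_conv_add_uminus)
    have "?K \<in> sets borel"
      unfolding K'eq using measurable_sets[of "(+) v" borel borel K] K(1) by simp
    moreover have "K \<inter> ?K = {}"
    proof (rule ccontr)
      assume "K \<inter> ?K \<noteq> {}"
      then obtain x where "x \<in> K" "v + x \<in> K" unfolding K'eq by auto
      then have "norm x \<le> r" "norm (v + x) \<le> r" using r by auto
      then show False using v(1) norm_triangle_ineq4[of "v + x" x] by simp
    qed
    ultimately have "indep_var point_sets (\<lambda>\<omega>. P \<omega> \<inter> K) point_sets (\<lambda>\<omega>. P \<omega> \<inter> ?K)"
      by (intro poisson_indep_restrict[OF E P K(1)])
    \<comment> \<open>The shifted process seen in \<open>K\<close> is the original seen in
      \<open>?K\<close>, moved by \<open>v\<close>; \<open>?D'\<close> expresses the shifted event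
      through the original, to which spatial independence applies.\<close>
    moreover have D': "{V \<in> space point_sets. (+) v ` V \<in> D} \<in> sets point_sets" (is "?D' \<in> _")
    proof -
      have "(\<lambda>V. (+) v ` V) \<in> point_sets \<rightarrow>\<^sub>M (point_sets :: 'a set measure)"
        by (rule measurable_point_sets_image[of _ _ "(+) (- v)"])
          (simp_all add: measurable_ident_sets bounded_translation_minus)
      from measurable_sets[OF this D] show ?thesis
        by (simp add: vimage_def Int_def conj_commute)
    qed
    ultimately have "prob ((\<lambda>\<omega>. (P \<omega> \<inter> K, P \<omega> \<inter> ?K)) -` (D \<times> ?D') \<inter> space M)
        = prob ((\<lambda>\<omega>. P \<omega> \<inter> K) -` D \<inter> space M) * prob ((\<lambda>\<omega>. P \<omega> \<inter> ?K) -` ?D' \<inter> space M)"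
      using D by (intro indep_varD)
    moreover have F: "(\<lambda>\<omega>. P \<omega> \<inter> K) -` D \<inter> space M = ?F"
      using DK locally_finite_value[OF P'(2)] by auto
    moreover have F': "(\<lambda>\<omega>. P \<omega> \<inter> ?K) -` ?D' \<inter> space M = ?F'"
    proof -
      have "P \<omega> \<inter> ?K \<in> ?D' \<longleftrightarrow> ?Q \<omega> \<in> D" if \<omega>: "\<omega> \<in> space M" for \<omega>
      proof -
        have "locally_finite (P \<omega> \<inter> ?K)"
          using locally_finite_value[OF P'(2) \<omega>] by (rule locally_finite_subset) auto
        moreover have "(+) v ` (P \<omega> \<inter> ?K) = ?Q \<omega> \<inter> K" unfolding K'eq by auto
        ultimately show ?thesis
          using DK[OF locally_finite_value[OF Q'(2) \<omega>]] by (simp add: space_point_sets)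
      qed
      then show ?thesis by auto
    qed
    moreover have "(\<lambda>\<omega>. (P \<omega> \<inter> K, P \<omega> \<inter> ?K)) -` (D \<times> ?D') \<inter> space M = ?F \<inter> ?F'"
      unfolding F[symmetric] F'[symmetric] by auto
    ultimately have "prob (?F \<inter> ?F') = prob ?F * prob ?F'" by simp
    \<comment> \<open>Both factors agree because the translated process has the same law.\<close>
    then have ind: "prob (?F \<inter> ?F') = (prob ?F)\<^sup>2" using law[OF D] by (simp add: power2_eq_square)
    have "\<bar>prob ?G - prob (?F \<inter> ?F')\<bar> \<le> prob (sym_diff ?G (?F \<inter> ?F'))"
      using evs by (intro measure_diff_le_sym_diff) auto
    also have "\<dots> \<le> prob (sym_diff ?G ?F \<union> sym_diff ?G ?F')"
      using evs by (intro finite_measure_mono) auto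
    also have "\<dots> \<le> prob (sym_diff ?G ?F) + prob (sym_diff ?G ?F')"
      using evs by (intro measure_Un_le) auto
    finally have 1: "\<bar>prob ?G - (prob ?F)\<^sup>2\<bar> \<le> 2 * \<epsilon>" using m1 m2 ind by simp
    have "\<bar>prob ?G - prob ?F\<bar> \<le> \<epsilon>"
      using measure_diff_le_sym_diff[OF evs(1,2)] m1 by simp
    moreover have "(prob ?G)\<^sup>2 - (prob ?F)\<^sup>2 = (prob ?G - prob ?F) * (prob ?G + prob ?F)"
      by (simp add: power2_eq_square algebra_simps)
    moreover have "prob ?G + prob ?F \<le> 2" using prob_le_1[of ?G] prob_le_1[of ?F] by linarith
    ultimately have 2: "\<bar>(prob ?G)\<^sup>2 - (prob ?F)\<^sup>2\<bar> \<le> \<epsilon> * 2"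
      unfolding abs_mult by (simp add: abs_mult) (intro mult_mono, auto)
    from 1 2 show ?thesis by linarith
  qed
  have "\<bar>?p - ?p\<^sup>2\<bar> \<le> 0 + \<epsilon>" if "0 < \<epsilon>" for \<epsilon>
    using *[of "\<epsilon> / 4"] that by simp
  then have "\<bar>?p - ?p\<^sup>2\<bar> \<le> 0" by (rule field_le_epsilon)
  then have "?p * (1 - ?p) = 0" by (simp add: power2_eq_square algebra_simps)
  then show ?thesis by auto
qed

section \<open>Random parking\<close>

lemma null_sets_lborel_hyperplane:
  fixes a :: "'a::euclidean_space"
  assumes "a \<noteq> 0"
  shows "{x. a \<bullet> x = b} \<in> null_sets lborel"
proof -
  have "closed {x. a \<bullet> x = b}" by (rule closed_hyperplane)
  then have "{x. a \<bullet> x = b} \<in> sets lborel" by (simp add: borel_closed)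
  then show ?thesis
    using negligible_hyperplane[of a b] assms null_sets_completion_iff[of "{x. a \<bullet> x = b}" lborel]
    by (simp add: negligible_iff_null_sets)
qed

lemma null_sets_lborel_sphere:
  fixes c :: "'a::euclidean_space"
  shows "sphere c r \<in> null_sets lborel"
proof -
  have "sphere c r \<in> sets lborel" by (simp add: borel_closed)
  moreover have "negligible (sphere c r)"
    using negligible_convex_frontier[OF convex_cball, of c r] by simp
  ultimately show ?thesis
    using null_sets_completion_iff[of "sphere c r" lborel]
    by (simp add: negligible_iff_null_sets)
qed

text \<open>A hyperplane cuts the paraboloid of points \<open>(x, x \<bullet> x)\<close> above a
  possibly degenerate sphere, or above a hyperplane when its last coefficient vanishes.\<close>

lemma null_sets_lborel_generalized_sphere:
  fixes a :: "'a::euclidean_space \<times> real"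
  assumes "a \<noteq> 0"
  shows "{x. a \<bullet> (x, x \<bullet> x) = b} \<in> null_sets lborel"
proof (cases "snd a = 0")
  case True
  then have "fst a \<noteq> 0" using assms by (auto simp: prod_eq_iff)
  from null_sets_lborel_hyperplane[OF this, of b] True show ?thesis
    by (simp add: inner_prod_def)
next
  case False
  define s where "s = snd a"
  \<comment> \<open>The centre arises from completing the square in
    \<open>fst a \<bullet> x + s * (x \<bullet> x) = b\<close>.\<close>
  define c where "c = (- 1 / (2 * s)) *\<^sub>R fst a"
  have s: "s \<noteq> 0" using False by (simp add: s_def)
  have "a \<bullet> (x, x \<bullet> x) = b \<longleftrightarrow> (x - c) \<bullet> (x - c) = b / s + c \<bullet> c" for x
  proof -
    have "(x - c) \<bullet> (x - c) = x \<bullet> x - 2 * (c \<bullet> x) + c \<bullet> c"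
      by (simp add: inner_diff_left inner_diff_right inner_commute)
    also have "2 * (c \<bullet> x) = - (fst a \<bullet> x) / s"
      using s by (simp add: c_def field_simps)
    finally show ?thesis
      using s by (simp add: inner_prod_def s_def[symmetric] field_simps)
  qed
  then have "{x. a \<bullet> (x, x \<bullet> x) = b} = {x. (dist c x)\<^sup>2 = b / s + c \<bullet> c}"
    by (simp add: dist_norm norm_minus_commute power2_norm_eq_inner)
  also have "\<dots> \<subseteq> sphere c (sqrt (b / s + c \<bullet> c))"
    by (auto simp: real_sqrt_unique)
  finally have sub: "{x. a \<bullet> (x, x \<bullet> x) = b} \<subseteq> sphere c (sqrt (b / s + c \<bullet> c))" .
  have "closed {x. a \<bullet> (x, x \<bullet> x) = b}"
    by (intro closed_Collect_eq continuous_intros)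
  then show ?thesis
    by (intro null_sets_subset[OF null_sets_lborel_sphere _ sub]) (simp add: borel_closed)
qed

lemma distr_lborel_linear_isometry:
  fixes g h :: "'a::euclidean_space \<Rightarrow> 'a"
  assumes lin: "linear g" and hg: "\<And>x. h (g x) = x" and gh: "\<And>x. g (h x) = x"
    and norm: "\<And>x. norm (g x) = norm x"
  shows "distr lborel borel g = lborel"
proof (rule measure_eqI)
  txt \<open>
    Uniqueness of translation invariant measures: for the unit ball \<open>B\<close>, Fubini and translations turn
    \<open>|B| \<cdot> |g\<^sup>-\<^sup>1 A|\<close> into \<open>|A| \<cdot> |B|\<close>. The library's \<open>measure_orthogonal_image\<close> would
    need a wellordered index type.
  \<close>
  have g[measurable]: "g \<in> borel_measurable borel"
    using lin by (intro borel_measurable_continuous_onI linear_continuous_on) (simp add: linear_conv_bounded_linear)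
  fix A assume "A \<in> sets (distr lborel borel g)"
  then have [measurable]: "A \<in> sets borel" by simp
  define B where "B = ball (0::'a) 1"
  have [measurable]: "B \<in> sets borel" by (simp add: B_def)
  let ?b = "emeasure lborel B"
  have shift: "(\<integral>\<^sup>+x. f (c + x) \<partial>lborel) = (\<integral>\<^sup>+x. f x \<partial>lborel)"
    if "f \<in> borel_measurable borel" for f :: "'a \<Rightarrow> ennreal" and c
    using nn_integral_distr[of "(+) c" lborel borel f] that by (simp add: lborel_distr_plus)
  have "?b * emeasure (distr lborel borel g) A = ?b * (\<integral>\<^sup>+y. indicator A (g y) \<partial>lborel)"
    by (subst nn_integral_indicator[symmetric], simp, subst nn_integral_distr) simp_all
  also have "\<dots> = (\<integral>\<^sup>+x. \<integral>\<^sup>+y. indicator B x * indicator A (g y) \<partial>lborel \<partial>lborel)"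
    by (simp add: nn_integral_cmult nn_integral_multc)
  also have "\<dots> = (\<integral>\<^sup>+x. \<integral>\<^sup>+y. indicator B x * indicator A (x + g y) \<partial>lborel \<partial>lborel)"
  proof (rule nn_integral_cong)
    fix x
    have "(\<integral>\<^sup>+y. indicator B x * indicator A (g (h x + y)) \<partial>lborel)
        = (\<integral>\<^sup>+y. indicator B x * indicator A (g y) \<partial>lborel)"
      by (rule shift) measurable
    then show "(\<integral>\<^sup>+y. indicator B x * indicator A (g y) \<partial>lborel)
        = (\<integral>\<^sup>+y. indicator B x * indicator A (x + g y) \<partial>lborel)"
      by (simp add: linear_add[OF lin] gh)
  qed
  also have "\<dots> = (\<integral>\<^sup>+y. \<integral>\<^sup>+x. indicator B x * indicator A (x + g y) \<partial>lborel \<partial>lborel)"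
    by (rule lborel_pair.Fubini') measurable
  also have "\<dots> = (\<integral>\<^sup>+y. \<integral>\<^sup>+x. indicator B (x - g y) * indicator A x \<partial>lborel \<partial>lborel)"
  proof (rule nn_integral_cong)
    fix y
    have "(\<integral>\<^sup>+x. indicator B (g y + x - g y) * indicator A (g y + x) \<partial>lborel)
        = (\<integral>\<^sup>+x. indicator B (x - g y) * indicator A x \<partial>lborel)"
      by (rule shift) measurable
    then show "(\<integral>\<^sup>+x. indicator B x * indicator A (x + g y) \<partial>lborel)
        = (\<integral>\<^sup>+x. indicator B (x - g y) * indicator A x \<partial>lborel)"
      by (simp add: add.commute)
  qed
  also have "\<dots> = (\<integral>\<^sup>+x. \<integral>\<^sup>+y. indicator B (x - g y) * indicator A x \<partial>lborel \<partial>lborel)"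
    by (rule lborel_pair.Fubini'[symmetric]) measurable
  also have "\<dots> = (\<integral>\<^sup>+x. ?b * indicator A x \<partial>lborel)"
  proof (rule nn_integral_cong)
    fix x
    have "norm (x - g y) = norm (y - h x)" for y
      using norm[of "h x - y"] by (simp add: linear_diff[OF lin] gh norm_minus_commute)
    then have "indicator B (x - g y) = (indicator B (y - h x) :: ennreal)" for y
      by (simp only: B_def indicator_def mem_ball_0)
    then have "(\<integral>\<^sup>+y. indicator B (x - g y) * indicator A x \<partial>lborel)
        = (\<integral>\<^sup>+y. indicator B (y - h x) * indicator A x \<partial>lborel)" by simp
    also have "\<dots> = (\<integral>\<^sup>+y. indicator B (h x + y - h x) * indicator A x \<partial>lborel)"
      by (rule shift[symmetric]) measurable
    also have "\<dots> = ?b * indicator A x" by (simp add: nn_integral_multc)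
    finally show "(\<integral>\<^sup>+y. indicator B (x - g y) * indicator A x \<partial>lborel) = ?b * indicator A x" .
  qed
  also have "\<dots> = ?b * emeasure lborel A" by (simp add: nn_integral_cmult)
  finally have "?b * emeasure (distr lborel borel g) A = ?b * emeasure lborel A" .
  moreover have "?b \<noteq> 0"
    using content_ball_pos[of 1 "0::'a"] by (auto simp: B_def measure_def)
  moreover have "?b \<noteq> \<top>" using emeasure_lborel_ball_finite[of "0::'a" 1] by (simp add: B_def)
  ultimately show "emeasure (distr lborel borel g) A = emeasure lborel A"
    by (simp add: ennreal_mult_cancel_left)
qed simp

lemma norm_orthogonal_matrix:
  fixes R :: "real ^ 'n ^ 'n"
  assumes "orthogonal_matrix R"
  shows "norm (R *v x) = norm x"
proof -
  have "orthogonal_transformation ((*v) R)"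
    using assms by (simp add: orthogonal_transformation_matrix)
  then show ?thesis by (simp add: orthogonal_transformation)
qed

text \<open>Acting on positions and fixing times preserves the region; as a linear isometry of
  space-time the map also preserves volume.\<close>

lemma unit_poisson_process_rotation:
  fixes R :: "real ^ 'd ^ 'd"
  assumes P: "unit_poisson_process M (UNIV \<times> {0..}) P" and R: "orthogonal_matrix R"
  shows "unit_poisson_process M (UNIV \<times> {0..}) (\<lambda>\<omega>. (\<lambda>p. (R *v fst p, snd p :: real)) ` P \<omega>)"
proof (rule unit_poisson_process_image[OF P, of "\<lambda>p. (transpose R *v fst p, snd p)"])
  note [simp del] = transpose_matrix_vector
  have inv: "transpose R *v (R *v x) = x" "R *v (transpose R *v x) = x" for x
    using R by (simp_all add: orthogonal_matrix_def matrix_vector_mul_assoc)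
  have lin: "linear (\<lambda>p. (S *v fst p, snd p :: real))" for S :: "real ^ 'd ^ 'd"
    by (rule linearI) (auto simp: matrix_vector_right_distrib matrix_vector_mult_scaleR)
  show g: "(transpose R *v fst (R *v fst p, snd p), snd (R *v fst p, snd p)) = p"
    "(R *v fst (transpose R *v fst p, snd p), snd (transpose R *v fst p, snd p)) = p" for p :: "(real ^ 'd) \<times> real"
    by (simp_all add: inv)
  show "(\<lambda>p. (R *v fst p, snd p :: real)) \<in> borel_measurable borel"
    using lin by (intro borel_measurable_continuous_onI linear_continuous_on) (simp add: linear_conv_bounded_linear)
  show "bounded ((\<lambda>p. (transpose R *v fst p, snd p)) ` A)" if "bounded A" for A :: "((real ^ 'd) \<times> real) set"
    using that lin by (intro bounded_linear_image) (auto simp: linear_conv_bounded_linear)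
  show "(R *v fst p, snd p) \<in> UNIV \<times> {0..} \<longleftrightarrow> p \<in> UNIV \<times> {0..}" for p :: "(real ^ 'd) \<times> real"
    by (cases p) auto
  show "distr lborel borel (\<lambda>p. (R *v fst p, snd p :: real)) = lborel"
    by (rule distr_lborel_linear_isometry[OF lin g])
      (simp add: norm_prod_def norm_orthogonal_matrix[OF R])
qed

section \<open>The parking set of a given Poisson process\<close>

locale parking_process =
  fixes M :: "'w measure" and \<rho> :: real and P :: "'w \<Rightarrow> ((real ^ 'd::{finite,linorder}) \<times> real) set"
  assumes \<rho>: "\<rho> > 0" and P: "unit_poisson_process M (UNIV \<times> {0..}) P"
begin

lemma borel_region: "UNIV \<times> {0..} \<in> sets (borel :: ((real ^ 'd::{finite,linorder}) \<times> real) measure)"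
  by (intro borel_closed closed_Times) auto

lemma borel_measurable_fst_snd:
  "fst \<in> borel_measurable (borel :: ((real ^ 'd::{finite,linorder}) \<times> real) measure)"
  "snd \<in> borel_measurable (borel :: ((real ^ 'd::{finite,linorder}) \<times> real) measure)"
  by (rule borel_measurable_continuous_onI[OF continuous_on_fst[OF continuous_on_id]],
      rule borel_measurable_continuous_onI[OF continuous_on_snd[OF continuous_on_id]])

lemma null_cylinder:
  assumes "N \<in> null_sets (lborel :: (real ^ 'd::{finite,linorder}) measure)"
  shows "{p :: (real ^ 'd::{finite,linorder}) \<times> real. fst p \<in> N} \<in> null_sets lborel"
proof -
  have "N \<times> UNIV \<in> null_sets (lborel \<Otimes>\<^sub>M (lborel :: real measure))"
    using assms by (intro lborel.times_in_null_sets1) auto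
  also have "N \<times> UNIV = {p :: (real ^ 'd::{finite,linorder}) \<times> real. fst p \<in> N}" by auto
  finally show ?thesis by (simp add: lborel_prod)
qed

lemma measurable_parking_poisson:
  assumes Q: "unit_poisson_process M (UNIV \<times> {0..}) Q"
  shows "(\<lambda>\<omega>. parking \<rho> (Q \<omega>)) \<in> measurable M point_sets"
  by (rule measurable_compose[OF unit_poisson_processD(2)[OF Q] measurable_parking[OF \<rho>]])

text \<open>The parking set is a measurable function of a process whose law is unique, so every
  transformation of \<open>P\<close> that keeps the Poisson axioms leaves its law unchanged.\<close>

lemma parking_law:
  assumes Q: "unit_poisson_process M (UNIV \<times> {0..}) Q"
  shows "distr M point_sets (\<lambda>\<omega>. parking \<rho> (Q \<omega>)) = distr M point_sets (\<lambda>\<omega>. parking \<rho> (P \<omega>))"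
proof -
  have eq: "distr M point_sets (\<lambda>\<omega>. parking \<rho> (X \<omega>)) = distr (distr M point_sets X) point_sets (parking \<rho>)"
    if "unit_poisson_process M (UNIV \<times> {0..}) X" for X
    using distr_distr[OF measurable_parking[OF \<rho>] unit_poisson_processD(2)[OF that]] by (simp add: comp_def)
  show ?thesis using poisson_law_unique[OF borel_region Q P] eq[OF Q] eq[OF P] by simp
qed

text \<open>Distances and lexicographic comparisons of positions survive a common translation, so
  the identity holds for every \<open>V\<close>, ties included.\<close>

lemma parking_translation: "parking \<rho> ((+) (x, 0) ` V) = (+) x ` parking \<rho> (V :: ((real ^ 'd::{finite,linorder}) \<times> real) set)"
  by (rule parking_image) (auto simp: parking_edge_iff less_fun_def)

lemma translation_preserves_region:
  "(x, 0) + p \<in> UNIV \<times> {0 :: real..} \<longleftrightarrow> p \<in> UNIV \<times> {0..}" for x :: "real ^ 'd::{finite,linorder}"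
  by (cases p) auto

lemma stationary_parking: "stationary M (\<lambda>\<omega>. parking \<rho> (P \<omega>))"
  unfolding stationary_def random_point_set_def
proof (intro conjI allI)
  show "prob_space M" by (rule unit_poisson_processD[OF P])
  show "(\<lambda>\<omega>. parking \<rho> (P \<omega>)) \<in> M \<rightarrow>\<^sub>M point_sets" by (rule measurable_parking_poisson[OF P])
  fix x :: "real ^ 'd::{finite,linorder}"
  have "unit_poisson_process M (UNIV \<times> {0..}) (\<lambda>\<omega>. (+) (x, 0) ` P \<omega>)"
    using translation_preserves_region by (rule unit_poisson_process_translation[OF P])
  from parking_law[OF this]
  show "distr M point_sets (\<lambda>\<omega>. (+) x ` parking \<rho> (P \<omega>)) = distr M point_sets (\<lambda>\<omega>. parking \<rho> (P \<omega>))"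
    by (simp add: parking_translation)
qed

text \<open>An invariant event for the parking set pulls back to a Poisson event invariant under the
  shifts \<open>(x, 0)\<close>, which is trivial.\<close>

lemma ergodic_parking: "ergodic M (\<lambda>\<omega>. parking \<rho> (P \<omega>))"
  unfolding ergodic_def random_point_set_def
proof (intro conjI ballI impI)
  show "prob_space M" by (rule unit_poisson_processD[OF P])
  show "(\<lambda>\<omega>. parking \<rho> (P \<omega>)) \<in> M \<rightarrow>\<^sub>M point_sets" by (rule measurable_parking_poisson[OF P])
  fix A :: "(real ^ 'd::{finite,linorder}) set set"
  assume A: "A \<in> sets point_sets" and inv: "\<forall>x. (\<lambda>Q. (+) x ` Q) ` A = A"
  define A' where "A' = parking \<rho> -` A \<inter> space point_sets"
  have A': "A' \<in> sets point_sets"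
    unfolding A'_def by (rule measurable_sets[OF measurable_parking[OF \<rho>] A])
  \<comment> \<open>Invariance is given as an equality of images; the opposite shift converts it
    into an equivalence of memberships.\<close>
  have invA: "(+) x ` S \<in> A \<longleftrightarrow> S \<in> A" for x S
  proof
    assume "(+) x ` S \<in> A"
    then have "(+) (- x) ` (+) x ` S \<in> A" using inv by blast
    then show "S \<in> A" by (simp add: image_image)
  next
    assume "S \<in> A"
    then show "(+) x ` S \<in> A" using inv by blast
  qed
  have "measure M {\<omega> \<in> space M. P \<omega> \<in> A'} \<in> {0, 1}"
  proof (rule poisson_invariant_event_trivial[OF borel_region P A'])
    fix r :: real
    \<comment> \<open>The absolute value covers negative \<open>r\<close>, and the added
      \<open>1\<close> makes the length exceed \<open>r\<close> strictly.\<close>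
    obtain x :: "real ^ 'd::{finite,linorder}" where x: "norm x = \<bar>r\<bar> + 1"
      using vector_choose_size[of "\<bar>r\<bar> + 1"] by auto
    have lf: "locally_finite ((+) (x, 0) ` V)" if "locally_finite V" for V :: "((real ^ 'd::{finite,linorder}) \<times> real) set"
    proof -
      have "(\<lambda>V. (+) (x, 0) ` V) \<in> point_sets \<rightarrow>\<^sub>M (point_sets :: ((real ^ 'd::{finite,linorder}) \<times> real) set measure)"
        by (rule measurable_point_sets_image[of _ _ "(+) (- (x, 0))"])
          (simp_all add: measurable_ident_sets bounded_translation_minus del: uminus_Pair)
      from locally_finite_value[OF this, of V] that show ?thesis by (simp add: space_point_sets)
    qed
    show "\<exists>v. r < norm v \<and> (\<forall>p. v + p \<in> UNIV \<times> {0..} \<longleftrightarrow> p \<in> UNIV \<times> {0..}) \<and>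
      (\<forall>V. locally_finite V \<longrightarrow> ((+) v ` V \<in> A' \<longleftrightarrow> V \<in> A'))"
    proof (intro exI[of _ "(x, 0)"] conjI allI impI translation_preserves_region)
      show "r < norm (x, 0 :: real)" using x by (simp add: norm_Pair)
      show "(+) (x, 0) ` V \<in> A' \<longleftrightarrow> V \<in> A'" if "locally_finite V" for V
        using lf[OF that] that by (simp add: A'_def space_point_sets parking_translation invA)
    qed
  qed
  also have "{\<omega> \<in> space M. P \<omega> \<in> A'} = {\<omega> \<in> space M. parking \<rho> (P \<omega>) \<in> A}"
    using locally_finite_value[OF unit_poisson_processD(2)[OF P]] by (auto simp: A'_def space_point_sets)
  finally show "measure M {\<omega> \<in> space M. parking \<rho> (P \<omega>) \<in> A} \<in> {0, 1}" .
qed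

text \<open>For \<open>snd\<close>, with values in dimension one, general position concerns
  singletons \<open>Q\<close> and says that times differ. The null sets it rests on are the time
  slices.\<close>

lemma no_simultaneous_arrivals: "AE \<omega> in M. inj_on snd (P \<omega>)"
proof -
  have "{p :: (real ^ 'd::{finite,linorder}) \<times> real. a \<bullet> snd p = b} \<in> null_sets lborel" if "a \<noteq> 0" for a b :: real
  proof -
    have "UNIV \<times> {t. a \<bullet> t = b} \<in> null_sets ((lborel :: (real ^ 'd::{finite,linorder}) measure) \<Otimes>\<^sub>M lborel)"
      by (intro lborel.times_in_null_sets2 null_sets_lborel_hyperplane that) auto
    also have "UNIV \<times> {t. a \<bullet> t = b} = {p :: (real ^ 'd::{finite,linorder}) \<times> real. a \<bullet> snd p = b}" by auto
    finally show ?thesis by (simp only: lborel_prod)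
  qed
  then have "AE \<omega> in M. in_general_position snd (P \<omega>)"
    by (rule poisson_general_position[OF borel_region P borel_measurable_fst_snd(2)])
  then show ?thesis
  proof eventually_elim
    case (elim \<omega>)
    show ?case
    proof (rule inj_onI, rule ccontr)
      fix p q assume pq: "p \<in> P \<omega>" "q \<in> P \<omega>" "snd p = snd q" "p \<noteq> q"
      then have "{p} \<subseteq> P \<omega> - {q}" "finite {p}" "card {p} \<le> DIM(real)" by auto
      with elim pq(2) have "snd q \<notin> affine hull (snd ` {p})"
        unfolding in_general_position_def by blast
      with pq show False by simp
    qed
  qed
qed

lemma isotropic_parking: "isotropic M (\<lambda>\<omega>. parking \<rho> (P \<omega>))"
  unfolding isotropic_def random_point_set_def
proof (intro conjI allI impI)
  show "prob_space M" by (rule unit_poisson_processD[OF P])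
  show park: "(\<lambda>\<omega>. parking \<rho> (P \<omega>)) \<in> M \<rightarrow>\<^sub>M point_sets" by (rule measurable_parking_poisson[OF P])
  fix R :: "((real, 'd) vec, 'd) vec" assume "rotation_matrix R"
  then have R: "orthogonal_matrix R" by (simp add: rotation_matrix_def)
  note [simp del] = transpose_matrix_vector
  have inv: "transpose R *v (R *v x) = x" "R *v (transpose R *v x) = x" for x
    using R by (simp_all add: orthogonal_matrix_def matrix_vector_mul_assoc)
  let ?g = "\<lambda>p. (R *v fst p, snd p :: real)"
  note Q = unit_poisson_process_rotation[OF P R]
  have dist: "dist (R *v x) (R *v y) = dist x y" for x y
    by (simp add: dist_norm norm_orthogonal_matrix[OF R] flip: matrix_vector_mult_diff_distrib)
  \<comment> \<open>The lexicographic order depends on the coordinate axes, so the identity is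
    claimed only away from simultaneous arrivals; an almost sure identity still yields equal
    laws.\<close>
  have "AE \<omega> in M. (*v) R ` parking \<rho> (P \<omega>) = parking \<rho> (?g ` P \<omega>)"
    using no_simultaneous_arrivals
  proof eventually_elim
    case (elim \<omega>)
    show ?case
    proof (rule parking_image[symmetric])
      show "inj_on ?g (P \<omega>)"
        by (rule inj_on_inverseI[of _ "\<lambda>p. (transpose R *v fst p, snd p)"]) (simp add: inv)
      show "fst (?g p) = R *v fst p" for p by simp
      fix p q assume pq: "p \<in> P \<omega>" "q \<in> P \<omega>"
      have irrefl: "\<not> parking_edge \<rho> p p" for p
        using less_fun_irrefl[of "($) (fst p)"] by (simp add: parking_edge_iff)
      show "parking_edge \<rho> (?g p) (?g q) \<longleftrightarrow> parking_edge \<rho> p q"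
      proof (cases "p = q")
        case False
        with pq elim have "snd p \<noteq> snd q" by (auto dest: inj_onD)
        then show ?thesis by (simp add: parking_edge_iff dist)
      qed (simp add: irrefl)
    qed
  qed
  moreover have "(\<lambda>\<omega>. (*v) R ` parking \<rho> (P \<omega>)) \<in> M \<rightarrow>\<^sub>M point_sets"
  proof (rule measurable_point_sets_image[OF park inv])
    show "(*v) R \<in> borel_measurable borel"
      by (intro borel_measurable_continuous_onI linear_continuous_on matrix_vector_mul_bounded_linear)
    show "bounded ((*v) (transpose R) ` A)" if "bounded A" for A
      by (rule bounded_linear_image[OF that matrix_vector_mul_bounded_linear])
  qed
  ultimately have "distr M point_sets (\<lambda>\<omega>. (*v) R ` parking \<rho> (P \<omega>)) = distr M point_sets (\<lambda>\<omega>. parking \<rho> (?g ` P \<omega>))"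
    by (intro distr_cong_AE measurable_parking_poisson[OF Q]) auto
  then show "distr M point_sets (\<lambda>\<omega>. (*v) R ` parking \<rho> (P \<omega>)) = distr M point_sets (\<lambda>\<omega>. parking \<rho> (P \<omega>))"
    using parking_law[OF Q] by simp
qed

text \<open>
  Points on a common sphere are exactly points whose images on the paraboloid \<open>x \<mapsto> (x, x \<bullet> x)\<close>
  lie in a common non-vertical hyperplane.
\<close>

lemma general_parking: "AE \<omega> in M. general (parking \<rho> (P \<omega>))"
proof -
  let ?\<phi> = "\<lambda>p :: (real ^ 'd::{finite,linorder}) \<times> real. (fst p, fst p \<bullet> fst p)"
  have \<phi>: "?\<phi> \<in> borel_measurable borel"
    by (intro borel_measurable_continuous_onI continuous_on_Pair continuous_on_inner continuous_on_fst continuous_on_id)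
  have "{p :: (real ^ 'd::{finite,linorder}) \<times> real. a \<bullet> fst p = b} \<in> null_sets lborel" if "a \<noteq> 0" for a b
    using null_cylinder[OF null_sets_lborel_hyperplane[OF that, of b]] by simp
  then have planes: "AE \<omega> in M. in_general_position fst (P \<omega>)"
    by (rule poisson_general_position[OF borel_region P borel_measurable_fst_snd(1)])
  have "{p :: (real ^ 'd::{finite,linorder}) \<times> real. a \<bullet> ?\<phi> p = b} \<in> null_sets lborel" if "a \<noteq> 0" for a b
    using null_cylinder[OF null_sets_lborel_generalized_sphere[OF that, of b]] by simp
  then have spheres: "AE \<omega> in M. in_general_position ?\<phi> (P \<omega>)"
    by (rule poisson_general_position[OF borel_region P \<phi>])
  from planes spheres show ?thesis
  proof eventually_elim
    case (elim \<omega>)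
    \<comment> \<open>One preimage per position keeps the cardinality, so that general position of
      the process applies to sets of positions.\<close>
    have lift: "\<exists>Q'\<subseteq>P \<omega>. Q = fst ` Q' \<and> finite Q' \<and> card Q' = card Q"
      if "Q \<subseteq> parking \<rho> (P \<omega>)" "finite Q" for Q
    proof -
      have "Q \<subseteq> fst ` P \<omega>" using that(1) parking_subset by fast
      then obtain Q' where Q': "Q' \<subseteq> P \<omega>" "inj_on fst Q'" "Q = fst ` Q'"
        by (auto simp: subset_image_inj)
      then show ?thesis using that(2) by (auto simp: card_image finite_image_iff)
    qed
    show ?case
      unfolding general_def
    proof (intro conjI allI impI notI)
      show "locally_finite (parking \<rho> (P \<omega>))" by (rule locally_finite_parking[OF \<rho>])
    next
      fix Q assume Q: "Q \<subseteq> parking \<rho> (P \<omega>)" "finite Q" "card Q = DIM(real ^ 'd::{finite,linorder}) + 1"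
        and "\<exists>a b. a \<noteq> 0 \<and> Q \<subseteq> {x. a \<bullet> x = b}"
      then obtain a b where a: "a \<noteq> 0" "Q \<subseteq> {x. a \<bullet> x = b}" by blast
      obtain Q' where Q': "Q' \<subseteq> P \<omega>" "Q = fst ` Q'" "finite Q'" "card Q' = card Q"
        using lift[OF Q(1,2)] by auto
      have "\<not> fst ` Q' \<subseteq> {x. a \<bullet> x = b}"
        by (rule general_position_not_in_hyperplane[OF elim(1) Q'(1,3) _ a(1)]) (simp only: Q'(4) Q(3))
      with a(2) Q'(2) show False by simp
    next
      fix Q assume Q: "Q \<subseteq> parking \<rho> (P \<omega>)" "finite Q" "card Q = DIM(real ^ 'd::{finite,linorder}) + 2"
        and "\<exists>c r. r > 0 \<and> Q \<subseteq> sphere c r"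
      then obtain c r where r: "Q \<subseteq> sphere c r" by blast
      obtain Q' where Q': "Q' \<subseteq> P \<omega>" "Q = fst ` Q'" "finite Q'" "card Q' = card Q"
        using lift[OF Q(1,2)] by auto
      \<comment> \<open>Expanding \<open>(x - c) \<bullet> (x - c) = r\<^sup>2\<close> gives this
        hyperplane in the coordinates \<open>(x, x \<bullet> x)\<close>.\<close>
      let ?a = "(- 2 *\<^sub>R c, 1 :: real)" and ?b = "r\<^sup>2 - c \<bullet> c"
      have "\<not> ?\<phi> ` Q' \<subseteq> {x. ?a \<bullet> x = ?b}"
      proof (rule general_position_not_in_hyperplane[OF elim(2) Q'(1,3)])
        \<comment> \<open>The lift adds one dimension, so two points more than the dimension of
          space are one more than that of the target.\<close>
        show "card Q' = DIM((real ^ 'd::{finite,linorder}) \<times> real) + 1" using Q'(4) Q(3) by simp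
        show "?a \<noteq> 0" by (simp add: zero_prod_def)
      qed
      moreover have "?\<phi> ` Q' \<subseteq> {x. ?a \<bullet> x = ?b}"
      proof clarsimp
        fix x t assume "(x, t) \<in> Q'"
        then have "dist c x = r" using r Q'(2) by force
        then have "r\<^sup>2 = (c - x) \<bullet> (c - x)" by (simp add: dist_norm power2_norm_eq_inner flip: \<open>dist c x = r\<close>)
        then show "x \<bullet> x - 2 * (c \<bullet> x) = r\<^sup>2 - c \<bullet> c"
          by (simp add: inner_diff_left inner_diff_right inner_commute)
      qed
      ultimately show False by blast
    qed
  qed
qed

end

theorem proposition2p1:
  fixes M :: "'w measure" and \<rho>\<^sub>0 :: real
    and \<xi> :: "'w \<Rightarrow> (real ^ 'd::{finite,linorder}) set"
  assumes "\<rho>\<^sub>0 > 0"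
    and "random_parking_measure M \<rho>\<^sub>0 \<xi>"
  shows "stationary M \<xi> \<and> ergodic M \<xi> \<and> isotropic M \<xi> \<and> (AE \<omega> in M. general (\<xi> \<omega>))"
proof -
  from assms(2) obtain P where P: "unit_poisson_process M (UNIV \<times> {0..}) P"
    and \<xi>: "\<And>\<omega>. \<omega> \<in> space M \<Longrightarrow> \<xi> \<omega> = parking \<rho>\<^sub>0 (P \<omega>)"
    unfolding random_parking_measure_def by blast
  interpret parking_process M \<rho>\<^sub>0 P by unfold_locales (fact assms(1), fact P)
  let ?\<xi> = "\<lambda>\<omega>. parking \<rho>\<^sub>0 (P \<omega>)"
  \<comment> \<open>\<open>\<xi>\<close> is prescribed only on \<open>space M\<close>, so each
    property is carried over from \<open>?\<xi>\<close> by congruence on that set.\<close>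
  have rps: "random_point_set M \<xi> \<longleftrightarrow> random_point_set M ?\<xi>"
    unfolding random_point_set_def using \<xi> by (simp cong: measurable_cong)
  have law: "distr M point_sets (\<lambda>\<omega>. f (\<xi> \<omega>)) = distr M point_sets (\<lambda>\<omega>. f (?\<xi> \<omega>))" for f
    by (rule distr_cong) (simp_all add: \<xi>)
  have "stationary M \<xi>"
    using stationary_parking law[of "\<lambda>S. S"] law[of "(`) ((+) x)" for x]
    by (simp add: stationary_def rps)
  moreover have "ergodic M \<xi>"
    using ergodic_parking by (simp add: ergodic_def rps \<xi> cong: conj_cong)
  moreover have "isotropic M \<xi>"
    unfolding isotropic_def rps
  proof (intro conjI allI impI)
    show "random_point_set M ?\<xi>" using isotropic_parking by (simp add: isotropic_def)
    fix R :: "((real, 'd) vec, 'd) vec" assume "rotation_matrix R"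
    with isotropic_parking show "distr M point_sets (\<lambda>\<omega>. (*v) R ` \<xi> \<omega>) = distr M point_sets \<xi>"
      using law[of "\<lambda>S. S"] law[of "\<lambda>S. (*v) R ` S"] by (simp add: isotropic_def)
  qed
  moreover have "AE \<omega> in M. general (\<xi> \<omega>)"
    using general_parking AE_space by eventually_elim (simp add: \<xi>)
  ultimately show ?thesis by blast
qed

end
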